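(* For any $n\ge1$, writing $\epsilon_{\mathrm{odd}}(F)$ for the expression equal to $0$ if $n$ is even and $F$ if $n$ is odd, and $\epsilon_{\mathrm{even}}(F)$ for $F$ if $n$ is even and $0$ if $n$ is odd: (i) $\sum_{\pi\in\mathfrak{S}_n(132)}(-1)^{\mathsf{des}\,\pi}q^{(2\text{-}31)\pi}=\sum_{\pi\in\mathfrak{S}_n(132)}(-1)^{\mathsf{des}\,\pi}q^{(2\text{-}13)\pi}=\epsilon_{\mathrm{odd}}\big((-q)^{(n-1)/2}C_{(n-1)/2}(q^2)\big)$; (ii) $\sum_{\pi\in\mathfrak{S}_n(213)}(-1)^{\mathsf{des}\,\pi}q^{(31\text{-}2)\pi}=\sum_{\pi\in\mathfrak{S}_n(213)}(-1)^{\mathsf{des}\,\pi}q^{(13\text{-}2)\pi}=\epsilon_{\mathrm{odd}}\big((-q)^{(n-1)/2}C_{(n-1)/2}(q^2)\big)$; (iii) $\sum_{\pi\in\mathfrak{S}_n(312)}(-1)^{\mathsf{des}\,\pi}q^{(2\text{-}31)\pi}=\sum_{\pi\in\mathfrak{S}_n(312)}(-1)^{\mathsf{des}\,\pi}q^{(2\text{-}13)\pi}=\epsilon_{\mathrm{odd}}\big((-q)^{(n-1)/2}C_{(n-1)/2}(q^2)\big)$; (iv) $\sum_{\pi\in\mathfrak{D}^*_n(132)}(-1)^{\mathsf{des}\,\pi}q^{(2\text{-}31)\pi}=\epsilon_{\mathrm{even}}\big((-1)^{n/2}\widehat{C}_{n/2}(q)\big)$; (v) $\sum_{\pi\in\mathfrak{D}^*_n(132)}(-q)^{\mathsf{des}\,\pi}q^{(31\text{-}2)\pi}=\epsilon_{\mathrm{even}}\big((-q)^{n/2}\overline{C}_{n/2}(q)\big)$;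 (vi) $\sum_{\pi\in\mathfrak{D}^*_n(213)}(-1)^{\mathsf{des}\,\pi}q^{(13\text{-}2)\pi}=\epsilon_{\mathrm{even}}\big((-1)^{n/2}q^{(n-2)/2}C_{(n-2)/2}(q^2)\big)$; (vii) $\sum_{\pi\in\mathfrak{D}^*_n(213)}(-q)^{\mathsf{des}\,\pi}q^{(31\text{-}2)\pi}=\epsilon_{\mathrm{even}}\big((-1)^{n/2}q^{(3n-4)/2}C_{(n-2)/2}(q^2)\big)$; where $\widehat{C}_m(q):=\sum_{\pi\in\mathfrak{A}_{2m}(231)}q^{(13\text{-}2)\pi}$ and $\overline{C}_m(q):=\sum_{\pi\in\mathfrak{A}_{2m}(231)}q^{(2\text{-}13)\pi}$.
   Context: $C_n(q):=C_n(q,q^2)$, where $C_n(t,q)$ is defined by $\sum_{n\ge0}C_n(t,q)z^n=1/(1-c_1z/(1-c_2z/(1-c_3z/\cdots)))$ with $c_{2k-1}=q^{k-1}$, $c_{2k}=tq^{k-1}$. $\mathfrak{S}_n(\tau)$: permutations of $[n]$ avoiding classical pattern $\tau$. For $\pi\in\mathfrak{S}_n$ set $\pi(n+1)=n+1$; $\pi(i)$ is a foremaximum if $\pi(i)<\pi(i+1)$ and $\pi(i)=\max\{\pi(1),\dots,\pi(i)\}$; a coderangement has no foremaximum; $\mathfrak{D}^*_n(\tau)$ is the set of coderangements in $\mathfrak{S}_n(\tau)$. $\mathfrak{A}_n(\tau)$ is the set of alternating (up-down) permutations $\pi(1)<\pi(2)>\pi(3)<\cdots$ in $\mathfrak{S}_n(\tau)$.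 $\mathsf{des}\,\pi=\#\{i\in[n-1]:\pi(i)>\pi(i+1)\}$; $(31\text{-}2)\pi=\#\{(i,j):i+1<j\le n,\pi(i+1)<\pi(j)<\pi(i)\}$, $(2\text{-}31)\pi=\#\{(i,j):j<i<n,\pi(i+1)<\pi(j)<\pi(i)\}$, $(2\text{-}13)\pi=\#\{(i,j):j<i<n,\pi(i)<\pi(j)<\pi(i+1)\}$, $(13\text{-}2)\pi=\#\{(i,j):i+1<j\le n,\pi(i)<\pi(j)<\pi(i+1)\}$. *)

theory Defs
  imports "HOL-Combinatorics.Multiset_Permutations" "HOL-Computational_Algebra.Formal_Power_Series"
begin

fun sfrac_trunc :: "(nat \<Rightarrow> 'a::field) \<Rightarrow> nat \<Rightarrow> nat \<Rightarrow> 'a fps" where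
  "sfrac_trunc c k 0 = 1"
| "sfrac_trunc c k (Suc d) = inverse (1 - fps_const (c k) * fps_X * sfrac_trunc c (Suc k) d)"

text \<open>The infinite S-fraction 1/(1 - c_1 z/(1 - c_2 z/...)): its n-th coefficient agrees with
  that of any truncation of depth at least n+1 (the truncation error is O(z^(depth))).\<close>
definition sfrac :: "(nat \<Rightarrow> 'a::field) \<Rightarrow> 'a fps" where
  "sfrac c = Abs_fps (\<lambda>n. fps_nth (sfrac_trunc c 1 (Suc n)) n)"

definition cat_weight :: "'a::field \<Rightarrow> 'a \<Rightarrow> nat \<Rightarrow> 'a" where
  "cat_weight t q j = (if odd j then q ^ ((j - 1) div 2) else t * q ^ (j div 2 - 1))"

definition Ctq :: "nat \<Rightarrow> 'a::field \<Rightarrow> 'a \<Rightarrow> 'a" where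
  "Ctq n t q = fps_nth (sfrac (cat_weight t q)) n"

definition Cq :: "nat \<Rightarrow> 'a::field \<Rightarrow> 'a" where
  "Cq n q = Ctq n q (q^2)"

section \<open>Permutations as lists [pi(1),...,pi(n)] (0-indexed positions)\<close>

definition perms :: "nat \<Rightarrow> nat list set" where
  "perms n = permutations_of_set {1..n}"

definition contains :: "nat list \<Rightarrow> nat list \<Rightarrow> bool" where
  "contains p tau \<longleftrightarrow> (\<exists>idx. length idx = length tau \<and> sorted_wrt (<) idx \<and>
      (\<forall>i\<in>set idx. i < length p) \<and>
      (\<forall>a<length tau. \<forall>b<length tau. (p ! (idx ! a) < p ! (idx ! b) \<longleftrightarrow> tau ! a < tau ! b)))"

definition avoiders :: "nat \<Rightarrow> nat list \<Rightarrow> nat list set" where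
  "avoiders n tau = {p \<in> perms n. \<not> contains p tau}"

definition ext :: "nat list \<Rightarrow> nat \<Rightarrow> nat" where
  "ext p i = (if i < length p then p ! i else length p + 1)"

definition foremax :: "nat list \<Rightarrow> nat \<Rightarrow> bool" where
  "foremax p i \<longleftrightarrow> i < length p \<and> ext p i < ext p (Suc i) \<and> (\<forall>k\<le>i. p ! k \<le> p ! i)"

definition coderangement :: "nat list \<Rightarrow> bool" where
  "coderangement p \<longleftrightarrow> (\<forall>i. \<not> foremax p i)"

definition coder_avoiders :: "nat \<Rightarrow> nat list \<Rightarrow> nat list set" where
  "coder_avoiders n tau = {p \<in> avoiders n tau. coderangement p}"

definition alternating :: "nat list \<Rightarrow> bool" where
  "alternating p \<longleftrightarrow> (\<forall>i. Suc i < length p \<longrightarrow>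
      (even i \<longrightarrow> p ! i < p ! Suc i) \<and> (odd i \<longrightarrow> p ! i > p ! Suc i))"

definition alt_avoiders :: "nat \<Rightarrow> nat list \<Rightarrow> nat list set" where
  "alt_avoiders n tau = {p \<in> avoiders n tau. alternating p}"

definition des :: "nat list \<Rightarrow> nat" where
  "des p = card {i. Suc i < length p \<and> p ! i > p ! Suc i}"

definition st31_2 :: "nat list \<Rightarrow> nat" where
  "st31_2 p = card {(i, j). Suc i < j \<and> j < length p \<and> p ! Suc i < p ! j \<and> p ! j < p ! i}"

definition st2_31 :: "nat list \<Rightarrow> nat" where
  "st2_31 p = card {(i, j). j < i \<and> Suc i < length p \<and> p ! Suc i < p ! j \<and> p ! j < p ! i}"

definition st2_13 :: "nat list \<Rightarrow> nat" where
  "st2_13 p = card {(i, j). j < i \<and> Suc i < length p \<and> p ! i < p ! j \<and> p ! j < p ! Suc i}"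

definition st13_2 :: "nat list \<Rightarrow> nat" where
  "st13_2 p = card {(i, j). Suc i < j \<and> j < length p \<and> p ! i < p ! j \<and> p ! j < p ! Suc i}"

definition Chat :: "nat \<Rightarrow> 'a::field \<Rightarrow> 'a" where
  "Chat m q = (\<Sum>p\<in>alt_avoiders (2*m) [2,3,1]. q ^ st13_2 p)"

definition Cbar :: "nat \<Rightarrow> 'a::field \<Rightarrow> 'a" where
  "Cbar m q = (\<Sum>p\<in>alt_avoiders (2*m) [2,3,1]. q ^ st2_13 p)"

definition eps_odd :: "nat \<Rightarrow> 'a::zero \<Rightarrow> 'a" where
  "eps_odd n F = (if odd n then F else 0)"

definition eps_even :: "nat \<Rightarrow> 'a::zero \<Rightarrow> 'a" where
  "eps_even n F = (if even n then F else 0)"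

end

theory Submission
  imports Defs
begin

text \<open>
  Reversal and complementation carry every class in the theorem to the 231-avoiders, except that
  a coderangement avoiding 213 must start with its maximum and is otherwise an arbitrary
  213-avoider. A 231-avoider splits at its maximum as \<open>L m R\<close> with all of \<open>L\<close> below all of \<open>R\<close>,
  and each of the statistics is additive under this splitting, possibly after prepending a
  smallest or largest letter to the word. Hence every signed sum satisfies a quadratic recurrence.
  At \<open>-1\<close> (or \<open>-q\<close>) the auxiliary series cancel and what is left is
  \<open>G(z) = z - c z G(z) G(qz)\<close>, whose solution is odd and is given by the Carlitz--Riordan numbers:
  the weights \<open>c\<^sub>j = Q\<^bsup>j-1\<^esup>\<close> of the S-fraction of \<open>C\<^sub>n(Q)\<close> amount to \<open>F(z) = 1 + z F(z) F(Qz)\<close>.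
  The splitting applied to alternating 231-avoiders gives the same recurrences
  without signs, which yields the two coderangement sums over 132-avoiders.
\<close>

section \<open>Patterns of length three and the decomposition of 231-avoiders\<close>

text \<open>Let x mark the ascents and let \<open>k\<close> be the length of \<open>L\<close>. For
  13-2 the splitting closes on itself; for 31-2 the maximum acts as a letter prepended to
  \<open>R\<close>, which brings in a second series with a quadratic equation of its own. The
  special values of x have two origins. If the sum multiplies itself, the terms with empty
  \<open>L\<close> and with empty \<open>R\<close> are A and x times the preceding sum, and x = -A
  removes both: A = 1 for 13-2, and A = q for 31-2 of the reversed word behind a prepended maximum.
  If two different series are multiplied, no such pair exists, and the auxiliary series H is removed
  through 1/(1 - G(z)) = 1 + z H(z) or a dilated variant of it. The hat and bar numbers enter
  without being evaluated. A signed sum that vanishes at even positive lengths leaves only odd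
  \<open>k\<close> in the convolution, and odd \<open>k\<close> is exactly what alternation imposes,
  since the maximum has to be a peak. So the signed and the alternating recurrences agree term by
  term up to a power of -1 or -q.\<close>

definition has3 :: "(nat \<Rightarrow> nat \<Rightarrow> nat \<Rightarrow> bool) \<Rightarrow> nat list \<Rightarrow> bool" where
  "has3 P p \<longleftrightarrow> (\<exists>i j k. i < j \<and> j < k \<and> k < length p \<and> P (p ! i) (p ! j) (p ! k))"

text \<open>Working with a predicate on three letters lets reversal and complementation act on the
  predicate instead of on the index list in \<open>contains\<close>. Both directions of each
  comparison occur because \<open>contains\<close> ranges over ordered pairs.\<close>

lemma contains_triple_iff:
  "contains p [u, v, w] \<longleftrightarrow>
    has3 (\<lambda>a b c. (a < b \<longleftrightarrow> u < v) \<and> (b < a \<longleftrightarrow> v < u) \<and> (a < c \<longleftrightarrow> u < w) \<and>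
                  (c < a \<longleftrightarrow> w < u) \<and> (b < c \<longleftrightarrow> v < w) \<and> (c < b \<longleftrightarrow> w < v)) p"
  (is "_ \<longleftrightarrow> has3 ?P p")
proof -
  have all3: "(\<forall>a<length [u, v, w]. Q a) \<longleftrightarrow> Q 0 \<and> Q 1 \<and> Q 2" for Q
    by (simp add: All_less_Suc2 numeral_2_eq_2)
  show ?thesis
  proof
    assume "contains p [u, v, w]"
    then obtain idx where l: "length idx = length [u, v, w]" and s: "sorted_wrt (<) idx"
      and r: "\<forall>i\<in>set idx. i < length p"
      and o: "\<forall>a<length [u, v, w]. \<forall>b<length [u, v, w].
          (p ! (idx ! a) < p ! (idx ! b) \<longleftrightarrow> [u, v, w] ! a < [u, v, w] ! b)"
      unfolding contains_def by blast
    obtain i j k where "idx = [i, j, k]"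
      using l by (auto simp: length_Suc_conv)
    with s r o show "has3 ?P p"
      unfolding has3_def all3 by (intro exI[of _ i] exI[of _ j] exI[of _ k]) simp
  next
    assume "has3 ?P p"
    then obtain i j k where "i < j" "j < k" "k < length p" "?P (p ! i) (p ! j) (p ! k)"
      unfolding has3_def by blast
    then show "contains p [u, v, w]"
      unfolding contains_def all3 by (intro exI[of _ "[i, j, k]"]) simp
  qed
qed

lemma has3_rev: "has3 P (rev p) \<longleftrightarrow> has3 (\<lambda>a b c. P c b a) p"
proof -
  have *: "has3 (\<lambda>a b c. P c b a) (rev p)" if h: "has3 P p" for P and p :: "nat list"
  proof -
    from h obtain i j k where "i < j" "j < k" "k < length p" "P (p ! i) (p ! j) (p ! k)"
      unfolding has3_def by blast
    then show ?thesis
      unfolding has3_def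
      by (intro exI[of _ "length p - Suc k"] exI[of _ "length p - Suc j"]
          exI[of _ "length p - Suc i"]) (auto simp: rev_nth)
  qed
  show ?thesis using *[of P "rev p"] *[of "\<lambda>a b c. P c b a" p] by auto
qed

lemma has3_map: "has3 P (map f p) \<longleftrightarrow> has3 (\<lambda>a b c. P (f a) (f b) (f c)) p"
  unfolding has3_def by (intro ex_cong1) auto

lemma has3_cong:
  assumes "\<And>a b c. a \<in> set p \<Longrightarrow> b \<in> set p \<Longrightarrow> c \<in> set p \<Longrightarrow> P a b c \<longleftrightarrow> P' a b c"
  shows "has3 P p \<longleftrightarrow> has3 P' p"
  unfolding has3_def using assms by (intro ex_cong1) auto

lemma has3_append:
  "has3 P (xs @ ys) \<longleftrightarrow> has3 P xs \<or> has3 P ys \<or>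
    (\<exists>i j c. i < j \<and> j < length xs \<and> c \<in> set ys \<and> P (xs ! i) (xs ! j) c) \<or>
    (\<exists>a j k. a \<in> set xs \<and> j < k \<and> k < length ys \<and> P a (ys ! j) (ys ! k))"
  (is "?l \<longleftrightarrow> ?A \<or> ?B \<or> ?C \<or> ?D")
proof
  assume ?l
  then obtain i j k where ijk: "i < j" "j < k" "k < length xs + length ys"
    and P: "P ((xs @ ys) ! i) ((xs @ ys) ! j) ((xs @ ys) ! k)"
    unfolding has3_def by auto
  consider "k < length xs" | "j < length xs" "length xs \<le> k"
    | "i < length xs" "length xs \<le> j" | "length xs \<le> i" by linarith
  then show "?A \<or> ?B \<or> ?C \<or> ?D"
  proof cases
    case 1
    then have ?A using ijk P unfolding has3_def
      by (intro exI[of _ i] exI[of _ j] exI[of _ k]) (auto simp: nth_append)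
    then show ?thesis ..
  next
    case 2
    then have ?C using ijk P
      by (intro exI[of _ i] exI[of _ j] exI[of _ "ys ! (k - length xs)"]) (auto simp: nth_append)
    then show ?thesis by blast
  next
    case 3
    then have ?D using ijk P
      by (intro exI[of _ "xs ! i"] exI[of _ "j - length xs"] exI[of _ "k - length xs"])
        (auto simp: nth_append)
    then show ?thesis by blast
  next
    case 4
    then have ?B using ijk P unfolding has3_def
      by (intro exI[of _ "i - length xs"] exI[of _ "j - length xs"] exI[of _ "k - length xs"])
        (auto simp: nth_append)
    then show ?thesis by blast
  qed
next
  assume "?A \<or> ?B \<or> ?C \<or> ?D"
  then consider ?A | ?B | ?C | ?D by blast
  then show ?l
  proof cases
    case 1
    then obtain i j k where "i < j" "j < k" "k < length xs" "P (xs ! i) (xs ! j) (xs ! k)"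
      unfolding has3_def by blast
    then show ?thesis unfolding has3_def
      by (intro exI[of _ i] exI[of _ j] exI[of _ k]) (auto simp: nth_append)
  next
    case 2
    then obtain i j k where "i < j" "j < k" "k < length ys" "P (ys ! i) (ys ! j) (ys ! k)"
      unfolding has3_def by blast
    then show ?thesis unfolding has3_def
      by (intro exI[of _ "length xs + i"] exI[of _ "length xs + j"] exI[of _ "length xs + k"]) auto
  next
    case 3
    then obtain i j k where "i < j" "j < length xs" "k < length ys" "P (xs ! i) (xs ! j) (ys ! k)"
      by (auto simp: in_set_conv_nth)
    then show ?thesis unfolding has3_def
      by (intro exI[of _ i] exI[of _ j] exI[of _ "length xs + k"]) (auto simp: nth_append)
  next
    case 4
    then obtain i j k where "i < length xs" "j < k" "k < length ys" "P (xs ! i) (ys ! j) (ys ! k)"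
      by (auto simp: in_set_conv_nth)
    then show ?thesis unfolding has3_def
      by (intro exI[of _ i] exI[of _ "length xs + j"] exI[of _ "length xs + k"])
        (auto simp: nth_append)
  qed
qed

lemma has3_Cons:
  "has3 P (x # ys) \<longleftrightarrow> has3 P ys \<or> (\<exists>j k. j < k \<and> k < length ys \<and> P x (ys ! j) (ys ! k))"
  using has3_append[of P "[x]" ys] by (auto simp: has3_def[of P "[x]"])

abbreviation has231 :: "nat list \<Rightarrow> bool" where
  "has231 \<equiv> has3 (\<lambda>a b c. c < a \<and> a < b)"

definition Av231 :: "nat \<Rightarrow> nat list set" where
  "Av231 n = avoiders n [2, 3, 1]"

lemma in_perms_iff: "p \<in> perms n \<longleftrightarrow> distinct p \<and> set p = {1..n}"
  by (auto simp: perms_def permutations_of_set_def)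

lemma length_perms: "p \<in> perms n \<Longrightarrow> length p = n"
  by (metis in_perms_iff distinct_card card_atLeastAtMost diff_Suc_1)

lemma finite_avoiders [simp]: "finite (avoiders n tau)"
  by (simp add: avoiders_def perms_def)

lemma finite_Av231 [simp]: "finite (Av231 n)"
  by (simp add: Av231_def)

lemma Av231_iff: "p \<in> Av231 n \<longleftrightarrow> p \<in> perms n \<and> \<not> has231 p"
proof -
  have "contains p [2, 3, 1] \<longleftrightarrow> has231 p"
    unfolding contains_triple_iff by (intro has3_cong) auto
  then show ?thesis by (simp add: Av231_def avoiders_def)
qed

lemma avoiders_132_iff: "p \<in> avoiders n [1, 3, 2] \<longleftrightarrow> p \<in> perms n \<and> \<not> has3 (\<lambda>a b c. a < c \<and> c < b) p"
proof -
  have "contains p [1, 3, 2] \<longleftrightarrow> has3 (\<lambda>a b c. a < c \<and> c < b) p"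
    unfolding contains_triple_iff by (intro has3_cong) auto
  then show ?thesis by (simp add: avoiders_def)
qed

lemma avoiders_213_iff: "p \<in> avoiders n [2, 1, 3] \<longleftrightarrow> p \<in> perms n \<and> \<not> has3 (\<lambda>a b c. b < a \<and> a < c) p"
proof -
  have "contains p [2, 1, 3] \<longleftrightarrow> has3 (\<lambda>a b c. b < a \<and> a < c) p"
    unfolding contains_triple_iff by (intro has3_cong) auto
  then show ?thesis by (simp add: avoiders_def)
qed

lemma avoiders_312_iff: "p \<in> avoiders n [3, 1, 2] \<longleftrightarrow> p \<in> perms n \<and> \<not> has3 (\<lambda>a b c. b < c \<and> c < a) p"
proof -
  have "contains p [3, 1, 2] \<longleftrightarrow> has3 (\<lambda>a b c. b < c \<and> c < a) p"
    unfolding contains_triple_iff by (intro has3_cong) auto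
  then show ?thesis by (simp add: avoiders_def)
qed

section \<open>Reversal and complementation\<close>

definition compl :: "nat \<Rightarrow> nat list \<Rightarrow> nat list" where
  "compl n p = map (\<lambda>x. Suc n - x) p"

lemma compl_perms: "p \<in> perms n \<Longrightarrow> compl n p \<in> perms n"
proof -
  assume p: "p \<in> perms n"
  have "inj_on (\<lambda>x. Suc n - x) {1..n}" by (auto simp: inj_on_def)
  moreover have "(\<lambda>x. Suc n - x) ` {1..n} = {1..n}"
  proof (intro equalityI subsetI)
    fix y assume "y \<in> {1..n}"
    then show "y \<in> (\<lambda>x. Suc n - x) ` {1..n}"
      by (intro image_eqI[of _ _ "Suc n - y"]) auto
  qed auto
  ultimately show ?thesis using p by (auto simp: in_perms_iff compl_def distinct_map)
qed

lemma compl_compl: "p \<in> perms n \<Longrightarrow> compl n (compl n p) = p"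
  by (auto simp: compl_def in_perms_iff intro!: map_idI)

lemma rev_perms [simp]: "rev p \<in> perms n \<longleftrightarrow> p \<in> perms n"
  by (simp add: in_perms_iff)

lemma compl_rev: "compl n (rev p) = rev (compl n p)"
  by (simp add: compl_def rev_map)

lemma has3_compl:
  assumes "p \<in> perms n"
  shows "has231 (compl n p) \<longleftrightarrow> has3 (\<lambda>a b c. b < a \<and> a < c) p"
    and "has3 (\<lambda>a b c. b < a \<and> a < c) (compl n p) \<longleftrightarrow> has231 p"
    and "has3 (\<lambda>a b c. b < c \<and> c < a) (compl n p) \<longleftrightarrow> has3 (\<lambda>a b c. a < c \<and> c < b) p"
    and "has3 (\<lambda>a b c. a < c \<and> c < b) (compl n p) \<longleftrightarrow> has3 (\<lambda>a b c. b < c \<and> c < a) p"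
  using assms unfolding compl_def has3_map by (auto intro!: has3_cong simp: in_perms_iff)

lemma sum_avoiders_132:
  "(\<Sum>p\<in>avoiders n [1, 3, 2]. w p) = (\<Sum>p\<in>Av231 n. w (rev p))"
  by (rule sum.reindex_bij_witness[of _ rev rev])
    (auto simp: Av231_iff avoiders_132_iff has3_rev simp del: One_nat_def)

lemma sum_avoiders_213:
  "(\<Sum>p\<in>avoiders n [2, 1, 3]. w p) = (\<Sum>p\<in>Av231 n. w (compl n p))"
  by (rule sum.reindex_bij_witness[of _ "compl n" "compl n"])
    (auto simp: Av231_iff avoiders_213_iff compl_compl compl_perms has3_compl simp del: One_nat_def)

text \<open>Complementing turns 312 into 132, and reversing turns 132 into 231.\<close>

lemma sum_avoiders_312:
  "(\<Sum>p\<in>avoiders n [3, 1, 2]. w p) = (\<Sum>p\<in>Av231 n. w (rev (compl n p)))"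
proof -
  have "(\<Sum>p\<in>avoiders n [3, 1, 2]. w p) = (\<Sum>p\<in>avoiders n [1, 3, 2]. w (compl n p))"
    by (rule sum.reindex_bij_witness[of _ "compl n" "compl n"])
      (auto simp: avoiders_312_iff avoiders_132_iff compl_compl compl_perms has3_compl
        simp del: One_nat_def)
  then show ?thesis by (simp only: sum_avoiders_132 compl_rev)
qed

section \<open>Splitting a 231-avoider at its maximum\<close>

definition glue :: "nat list \<Rightarrow> nat list \<Rightarrow> nat list" where
  "glue L R = L @ Suc (length L + length R) # map (\<lambda>x. x + length L) R"

text \<open>Everything to the right of \<open>L\<close> exceeds \<open>L\<close>, so a 231 whose
  first letter lies in \<open>L\<close> has its last letter, and hence all of it, in
  \<open>L\<close>. The maximum cannot play the first letter, which leaves only occurrences inside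
  \<open>R\<close>.\<close>

lemma glue_Av231:
  assumes L: "L \<in> Av231 k" and R: "R \<in> Av231 l"
  shows "glue L R \<in> Av231 (Suc (k + l))"
proof -
  have len: "length L = k" "length R = l" using L R length_perms by (auto simp: Av231_iff)
  have sL: "set L = {1..k}" "distinct L" and sR: "set R = {1..l}" "distinct R"
    using L R by (auto simp: Av231_iff in_perms_iff)
  have im: "(\<lambda>x. x + k) ` {1..l} = {Suc k..k + l}"
  proof (intro equalityI subsetI)
    fix y assume "y \<in> {Suc k..k + l}"
    then show "y \<in> (\<lambda>x. x + k) ` {1..l}"
      by (intro image_eqI[of _ _ "y - k"]) auto
  qed auto
  have perm: "glue L R \<in> perms (Suc (k + l))"
    using sL sR unfolding in_perms_iff glue_def len
    by (auto simp: distinct_map im inj_on_def)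
  have hL: "\<not> has231 L" and hR: "\<not> has231 R" using L R by (auto simp: Av231_iff)
  have hR': "\<not> has231 (map (\<lambda>x. x + k) R)" unfolding has3_map using hR by simp
  have bL: "x < Suc (k + l)" "x \<le> k" if "x \<in> set L" for x using that sL by auto
  have bR: "k < x" "x \<le> k + l" if "x \<in> set (map (\<lambda>x. x + k) R)" for x
    using that unfolding set_map sR im by auto
  have hm: "\<not> has231 (Suc (k + l) # map (\<lambda>x. x + k) R)"
  proof
    assume "has231 (Suc (k + l) # map (\<lambda>x. x + k) R)"
    then have "\<exists>j m. j < m \<and> m < length R \<and> Suc (k + l) < map (\<lambda>x. x + k) R ! j"
      unfolding has3_Cons using hR' by (metis length_map)
    then obtain j where "j < length R" "Suc (k + l) < map (\<lambda>x. x + k) R ! j"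
      by (meson less_trans)
    then show False using bR(2)[of "map (\<lambda>x. x + k) R ! j"] by simp
  qed
  have bm: "k < x" if "x \<in> set (Suc (k + l) # map (\<lambda>x. x + k) R)" for x
    using that bR by auto
  have "\<not> has231 (L @ Suc (k + l) # map (\<lambda>x. x + k) R)"
    unfolding has3_append
  proof (intro notI, elim disjE)
    assume "\<exists>i j c. i < j \<and> j < length L \<and> c \<in> set (Suc (k + l) # map (\<lambda>x. x + k) R) \<and>
      c < L ! i \<and> L ! i < L ! j"
    then obtain i j c where "j < length L" "c \<in> set (Suc (k + l) # map (\<lambda>x. x + k) R)"
      "c < L ! i" "L ! i < L ! j" by blast
    with bm bL(2)[of "L ! j"] show False by fastforce
  next
    assume "\<exists>a j m. a \<in> set L \<and> j < m \<and> m < length (Suc (k + l) # map (\<lambda>x. x + k) R) \<and>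
      (Suc (k + l) # map (\<lambda>x. x + k) R) ! m < a \<and> a < (Suc (k + l) # map (\<lambda>x. x + k) R) ! j"
    then obtain a m where "a \<in> set L" "m < length (Suc (k + l) # map (\<lambda>x. x + k) R)"
      "(Suc (k + l) # map (\<lambda>x. x + k) R) ! m < a" by blast
    with bm[OF nth_mem, of m] bL(2)[of a] show False by linarith
  qed (use hL hm in auto)
  with perm show ?thesis unfolding Av231_iff glue_def len by simp
qed

lemma initial_segment_split:
  fixes A B :: "nat set"
  assumes "A \<union> B = {1..n}" and "\<And>a b. a \<in> A \<Longrightarrow> b \<in> B \<Longrightarrow> a < b"
  shows "A = {1..card A}" "B = {Suc (card A)..n}"
proof -
  have "\<exists>k\<le>n. A = {1..k}"
  proof (cases "A = {}")
    case False
    have fin: "finite A" using assms(1) by (metis finite_Un finite_atLeastAtMost)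
    have "A = {1..Max A}"
    proof (intro equalityI subsetI)
      fix x assume "x \<in> A"
      then show "x \<in> {1..Max A}" using fin assms(1) by auto
    next
      fix x assume x: "x \<in> {1..Max A}"
      have M: "Max A \<in> A" using fin False by simp
      then have "Max A \<le> n" using assms(1) by auto
      then have "x \<in> A \<union> B" unfolding assms(1) using x by simp
      moreover have "x \<notin> B" using assms(2)[OF M] x by force
      ultimately show "x \<in> A" by simp
    qed
    moreover have "Max A \<le> n" using Max_in[OF fin False] assms(1) by fastforce
    ultimately show ?thesis by blast
  qed auto
  then obtain k where k: "k \<le> n" "A = {1..k}" by blast
  then have c: "card A = k" by simp
  show "A = {1..card A}" using k(2) c by simp
  have "A \<inter> B = {}" using assms(2) by fastforce
  then have "B = {1..n} - {1..k}" using assms(1) k(2) by blast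
  then show "B = {Suc (card A)..n}" unfolding c by auto
qed

lemma Av231_SucE:
  assumes "p \<in> Av231 (Suc n)"
  obtains k L R where "k \<le> n" "L \<in> Av231 k" "R \<in> Av231 (n - k)" "p = glue L R"
proof -
  have dp: "distinct p" and sp: "set p = {1..Suc n}" and hp: "\<not> has231 p"
    using assms by (auto simp: Av231_iff in_perms_iff)
  have "Suc n \<in> set p" using sp by simp
  then obtain L R' where p: "p = L @ Suc n # R'" by (meson split_list)
  have un: "set L \<union> set R' = {1..n}"
  proof -
    have "set L \<union> set R' = set p - {Suc n}" using dp p by auto
    also have "\<dots> = {1..n}" unfolding sp by (simp add: atLeastAtMostSuc_conv)
    finally show ?thesis .
  qed
  \<comment> \<open>Otherwise \<open>a\<close>, the maximum and \<open>b\<close> would form a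
    231.\<close>
  have lt: "a < b" if a: "a \<in> set L" and b: "b \<in> set R'" for a b
  proof (rule ccontr)
    assume "\<not> a < b"
    moreover have "a \<noteq> b" using dp p a b by auto
    ultimately have "b < a" by simp
    moreover from b obtain m where m: "m < length R'" "b = R' ! m" by (auto simp: in_set_conv_nth)
    moreover have "a \<in> {1..n}" using un a by blast
    then have "a < Suc n" by simp
    ultimately have "has231 (L @ Suc n # R')"
      using a unfolding has3_append by (intro disjI2 exI[of _ a] exI[of _ 0] exI[of _ "Suc m"]) auto
    with hp p show False by simp
  qed
  define k where "k = length L"
  have dL: "distinct L" and dR': "distinct R'" using dp p by auto
  have cL: "card (set L) = k" using dL by (simp add: distinct_card k_def)
  have sL: "set L = {1..k}" and sR': "set R' = {Suc k..n}"
    using initial_segment_split[OF un lt] cL by auto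
  have kn: "k \<le> n" using card_mono[of "{1..n}" "set L"] Un_upper1[of "set L" "set R'"] un cL by simp
  define R where "R = map (\<lambda>x. x - k) R'"
  have R': "R' = map (\<lambda>x. x + k) R"
    unfolding R_def map_map using sR' by (auto intro!: map_idI[symmetric])
  have sR: "set R = {1..n - k}"
  proof -
    have "(\<lambda>x. x - k) ` {Suc k..n} = {1..n - k}"
    proof (intro equalityI subsetI)
      fix y assume "y \<in> {1..n - k}"
      then show "y \<in> (\<lambda>x. x - k) ` {Suc k..n}"
        by (intro image_eqI[of _ _ "y + k"]) auto
    qed auto
    then show ?thesis by (simp add: R_def sR')
  qed
  have dR: "distinct R" using dR' unfolding R' by (simp add: distinct_map)
  have Rp: "R \<in> perms (n - k)" using sR dR by (simp add: in_perms_iff)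
  then have lR: "length R = n - k" by (rule length_perms)
  have hL: "\<not> has231 L" and "\<not> has231 (Suc n # R')" using hp p by (auto simp: has3_append)
  then have "\<not> has231 R'" unfolding has3_Cons by blast
  then have hR: "\<not> has231 R" unfolding R' has3_map by simp
  have "p = glue L R" using p kn by (simp add: glue_def lR R' k_def)
  with kn hL hR Rp sL dL show ?thesis
    by (intro that[of k L R]) (auto simp: Av231_iff in_perms_iff)
qed

text \<open>The splitting is unique because the maximum \<open>Suc n\<close> occurs exactly once, so
  its position recovers both blocks.\<close>

lemma sum_Av231_Suc:
  "(\<Sum>p\<in>Av231 (Suc n). w p) = (\<Sum>k\<le>n. \<Sum>L\<in>Av231 k. \<Sum>R\<in>Av231 (n - k). w (glue L R))"
proof -
  let ?S = "SIGMA k:{..n}. Av231 k \<times> Av231 (n - k)"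
  have "bij_betw (\<lambda>(k, L, R). glue L R) ?S (Av231 (Suc n))"
  proof (rule bij_betwI')
    fix x y assume x: "x \<in> ?S" and y: "y \<in> ?S"
    obtain k L R where X: "x = (k, L, R)" by (cases x)
    obtain k' L' R' where Y: "y = (k', L', R')" by (cases y)
    have k: "length L = k" "length R = n - k" "k \<le> n"
      and k': "length L' = k'" "length R' = n - k'" "k' \<le> n"
      using x y X Y length_perms by (auto simp: Av231_iff)
    have nin: "Suc n \<notin> set L" "Suc n \<notin> set L'"
      using x y X Y by (auto simp: Av231_iff in_perms_iff)
    have "Suc n \<notin> set (map (\<lambda>x. x + k) R)" "Suc n \<notin> set (map (\<lambda>x. x + k') R')"
      using x y X Y by (auto simp: Av231_iff in_perms_iff)
    then have "glue L R = glue L' R' \<longleftrightarrow> L = L' \<and> R = R'"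
      using nin k k' append_Cons_eq_iff[of "Suc n" L "map (\<lambda>x. x + k) R" L' "map (\<lambda>x. x + k') R'"]
      by (auto simp: glue_def inj_on_def dest!: map_injective)
    then show "((case x of (k, L, R) \<Rightarrow> glue L R) = (case y of (k, L, R) \<Rightarrow> glue L R)) = (x = y)"
      using X Y k k' by auto
  next
    fix x assume "x \<in> ?S"
    then obtain k L R where "x = (k, L, R)" "k \<le> n" "L \<in> Av231 k" "R \<in> Av231 (n - k)" by auto
    then show "(case x of (k, L, R) \<Rightarrow> glue L R) \<in> Av231 (Suc n)"
      using glue_Av231[of L k R "n - k"] by simp
  next
    fix p assume "p \<in> Av231 (Suc n)"
    then show "\<exists>x\<in>?S. p = (case x of (k, L, R) \<Rightarrow> glue L R)"
      by (elim Av231_SucE) (auto intro!: bexI[where x = "(_, _, _)"])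
  qed
  then have "(\<Sum>p\<in>Av231 (Suc n). w p) = (\<Sum>(k, L, R)\<in>?S. w (glue L R))"
    by (subst sum.reindex_bij_betw[symmetric]) (auto simp: case_prod_unfold)
  also have "\<dots> = (\<Sum>k\<le>n. \<Sum>L\<in>Av231 k. \<Sum>R\<in>Av231 (n - k). w (glue L R))"
    by (subst sum.Sigma[symmetric]) (auto simp: sum.cartesian_product)
  finally show ?thesis .
qed

section \<open>Vincular statistics on lists\<close>

fun adj :: "(nat \<Rightarrow> nat \<Rightarrow> bool) \<Rightarrow> nat list \<Rightarrow> nat" where
  "adj P (a # b # xs) = of_bool (P a b) + adj P (b # xs)"
| "adj P _ = 0"

text \<open>Only patterns whose adjacent pair comes first are modelled; those with the pair at the
  end are read off the reversed word.\<close>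

fun vinc :: "(nat \<Rightarrow> nat \<Rightarrow> nat \<Rightarrow> bool) \<Rightarrow> nat list \<Rightarrow> nat" where
  "vinc P (a # b # xs) = length (filter (P a b) xs) + vinc P (b # xs)"
| "vinc P _ = 0"

abbreviation asc :: "nat list \<Rightarrow> nat" where
  "asc \<equiv> adj (<)"

abbreviation v31_2 :: "nat list \<Rightarrow> nat" where
  "v31_2 \<equiv> vinc (\<lambda>a b c. b < c \<and> c < a)"

abbreviation v13_2 :: "nat list \<Rightarrow> nat" where
  "v13_2 \<equiv> vinc (\<lambda>a b c. a < c \<and> c < b)"

lemma card_adjacent_eq_adj: "card {i. Suc i < length p \<and> P (p ! i) (p ! Suc i)} = adj P p"
proof (induction P p rule: adj.induct)
  case (1 P a b xs)
  let ?S = "{i. Suc i < length (b # xs) \<and> P ((b # xs) ! i) ((b # xs) ! Suc i)}"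
  have "{i. Suc i < length (a # b # xs) \<and> P ((a # b # xs) ! i) ((a # b # xs) ! Suc i)}
      = (if P a b then {0} else {}) \<union> Suc ` ?S" (is "?T = _")
  proof (intro equalityI subsetI)
    fix i assume "i \<in> ?T"
    then show "i \<in> (if P a b then {0} else {}) \<union> Suc ` ?S" by (cases i) auto
  qed (auto split: if_splits)
  moreover have "finite ?S" by (rule finite_subset[of _ "{..<length (b # xs)}"]) auto
  ultimately show ?case using 1 by (simp add: card_Un_disjoint card_image card_insert_if)
qed auto

lemma card_vincular_eq_vinc:
  "card {(i, j). Suc i < j \<and> j < length p \<and> P (p ! i) (p ! Suc i) (p ! j)} = vinc P p"
proof (induction P p rule: vinc.induct)
  case (1 P a b xs)
  let ?A = "\<lambda>p. {(i, j). Suc i < j \<and> j < length p \<and> P (p ! i) (p ! Suc i) (p ! j)}"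
  let ?S = "{j. j < length xs \<and> P a b (xs ! j)}"
  have eq: "?A (a # b # xs) = (\<lambda>j. (0, Suc (Suc j))) ` ?S \<union> map_prod Suc Suc ` ?A (b # xs)"
  proof (intro equalityI subsetI)
    fix x assume "x \<in> ?A (a # b # xs)"
    then obtain i j where x: "x = (i, j)" "Suc i < j" "j < length (a # b # xs)"
      "P ((a # b # xs) ! i) ((a # b # xs) ! Suc i) ((a # b # xs) ! j)" by blast
    show "x \<in> (\<lambda>j. (0, Suc (Suc j))) ` ?S \<union> map_prod Suc Suc ` ?A (b # xs)"
    proof (cases i)
      case 0
      then have "x = (0, Suc (Suc (j - 2)))" "j - 2 \<in> ?S" using x by (auto simp: numeral_2_eq_2)
      then show ?thesis by blast
    next
      case (Suc i')
      then obtain j' where j: "j = Suc j'" using x by (cases j) auto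
      then have "x = map_prod Suc Suc (i', j')" "(i', j') \<in> ?A (b # xs)" using x Suc by auto
      then show ?thesis by blast
    qed
  qed auto
  have "finite (?A (b # xs))"
    by (rule finite_subset[of _ "{..<length (b # xs)} \<times> {..<length (b # xs)}"]) auto
  then have "card (?A (a # b # xs)) = card ?S + card (?A (b # xs))"
    unfolding eq by (subst card_Un_disjoint) (auto simp: card_image inj_on_def)
  then show ?case using 1 by (simp add: length_filter_conv_card)
qed (auto simp: card_eq_0_iff)

lemma des_eq_adj: "des p = adj (>) p"
  unfolding des_def by (rule card_adjacent_eq_adj)

lemma st31_2_eq_vinc: "st31_2 p = v31_2 p"
  unfolding st31_2_def by (rule card_vincular_eq_vinc)

lemma st13_2_eq_vinc: "st13_2 p = v13_2 p"
  unfolding st13_2_def by (rule card_vincular_eq_vinc)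

lemma card_vincular_rev:
  "card {(i, j). j < i \<and> Suc i < length p \<and> P (p ! i) (p ! Suc i) (p ! j)} =
   vinc (\<lambda>a b c. P b a c) (rev p)"
proof -
  \<comment> \<open>The pair at \<open>i\<close>, \<open>Suc i\<close> moves to the positions
    \<open>length p - 2 - i\<close>, \<open>length p - 1 - i\<close>, so the index of its left end
    shifts by one more than that of the single letter. The map is its own inverse.\<close>
  let ?f = "\<lambda>(i, j). (length p - Suc (Suc i), length p - Suc j)"
  have "bij_betw ?f {(i, j). j < i \<and> Suc i < length p \<and> P (p ! i) (p ! Suc i) (p ! j)}
    {(i, j). Suc i < j \<and> j < length (rev p) \<and> P (rev p ! Suc i) (rev p ! i) (rev p ! j)}"
    by (rule bij_betw_byWitness[of _ ?f]) (auto simp: rev_nth Suc_diff_Suc)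
  then show ?thesis
    unfolding card_vincular_eq_vinc[symmetric] by (rule bij_betw_same_card)
qed

lemma st2_31_eq_vinc: "st2_31 p = v13_2 (rev p)"
  unfolding st2_31_def by (rule card_vincular_rev)

lemma st2_13_eq_vinc: "st2_13 p = v31_2 (rev p)"
  unfolding st2_13_def by (rule card_vincular_rev)

lemma adj_append: "adj P (xs @ y # ys) = adj P (xs @ [y]) + adj P (y # ys)"
  by (induction P xs rule: adj.induct) auto

lemma adj_snoc: "adj P (xs @ [y]) = adj P xs + (if xs = [] then 0 else of_bool (P (last xs) y))"
  by (induction P xs rule: adj.induct) auto

lemma adj_Cons: "adj P (x # xs) = (if xs = [] then 0 else of_bool (P x (hd xs))) + adj P xs"
  by (cases xs) auto

lemma adj_rev: "adj P (rev p) = adj (\<lambda>a b. P b a) p"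
  by (induction p) (auto simp: adj_snoc adj_Cons last_rev)

lemma adj_map: "adj P (map f p) = adj (\<lambda>a b. P (f a) (f b)) p"
  by (induction P p rule: adj.induct) auto

lemma adj_cong:
  assumes "\<And>a b. a \<in> set p \<Longrightarrow> b \<in> set p \<Longrightarrow> P a b \<longleftrightarrow> P' a b"
  shows "adj P p = adj P' p"
  using assms by (induction P p rule: adj.induct) auto

lemma des_rev: "des (rev p) = asc p"
  by (simp add: des_eq_adj adj_rev)

lemma asc_plus_des: "distinct p \<Longrightarrow> asc p + des p = length p - 1"
proof -
  have "distinct p \<Longrightarrow> asc p + adj (>) p = length p - 1"
    by (induction "(<) :: nat \<Rightarrow> nat \<Rightarrow> bool" p rule: adj.induct) auto
  then show "distinct p \<Longrightarrow> ?thesis" by (simp add: des_eq_adj)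
qed

lemma vinc_map: "vinc P (map f p) = vinc (\<lambda>a b c. P (f a) (f b) (f c)) p"
  by (induction P p rule: vinc.induct) (auto simp: filter_map comp_def)

lemma vinc_cong:
  assumes "\<And>a b c. a \<in> set p \<Longrightarrow> b \<in> set p \<Longrightarrow> c \<in> set p \<Longrightarrow> P a b c \<longleftrightarrow> P' a b c"
  shows "vinc P p = vinc P' p"
  using assms
proof (induction P p rule: vinc.induct)
  case (1 P a b xs)
  then have "filter (P a b) xs = filter (P' a b) xs" by (intro filter_cong) auto
  with 1 show ?case by simp
qed auto

lemma vinc_Cons:
  "vinc P (x # xs) = (if xs = [] then 0 else length (filter (P x (hd xs)) (tl xs))) + vinc P xs"
  by (cases xs) auto

text \<open>The hypothesis excludes pairs inside \<open>xs\<close> with the third letter beyond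
  \<open>xs\<close>; the junction \<open>last xs\<close>, \<open>y\<close> is then the only pair
  that belongs to neither part. After a split at the maximum it holds because all letters of one
  block lie below those of the other.\<close>

lemma vinc_append:
  assumes "\<And>a b c. a \<in> set xs \<Longrightarrow> b \<in> set xs \<Longrightarrow> c \<in> set (y # ys) \<Longrightarrow> \<not> P a b c"
  shows "vinc P (xs @ y # ys) =
    vinc P xs + (if xs = [] then 0 else length (filter (P (last xs) y) ys)) + vinc P (y # ys)"
  using assms
proof (induction P xs rule: vinc.induct)
  case (1 P a b xs)
  then have "filter (P a b) (y # ys) = []" by (intro filter_False) auto
  then have "\<not> P a b y" "filter (P a b) ys = []" by (auto split: if_splits)
  with 1 show ?case by simp
qed auto

text \<open>A leading letter above all others serves only as an upper bound that every letter meets.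
  This lets the maximum of the whole word be replaced by one just above a single block.\<close>

lemma v31_2_Cons_big:
  assumes "\<And>x. x \<in> set p \<Longrightarrow> x < M" "\<And>x. x \<in> set p \<Longrightarrow> x < M'"
  shows "v31_2 (M # p) = v31_2 (M' # p)"
proof (cases p)
  case (Cons a xs)
  then have "filter (\<lambda>c. a < c \<and> c < M) xs = filter (\<lambda>c. a < c \<and> c < M') xs"
    using assms by (intro filter_cong) auto
  then show ?thesis using Cons by simp
qed auto

lemma st_compl:
  assumes "p \<in> perms n"
  shows "v31_2 (compl n p) = v13_2 p" "v13_2 (compl n p) = v31_2 p"
    "des (compl n p) = asc p" "asc (compl n p) = des p"
  using assms unfolding compl_def vinc_map des_eq_adj adj_map
  by (auto intro!: vinc_cong adj_cong simp: in_perms_iff)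

section \<open>Statistics under gluing\<close>

context
  fixes L R :: "nat list" and k l :: nat
  assumes L: "L \<in> Av231 k" and R: "R \<in> Av231 l"
begin

lemma glue_lengths: "length L = k" "length R = l"
  using L R by (simp_all add: Av231_iff length_perms)

lemma glue_eq: "glue L R = L @ Suc (k + l) # map (\<lambda>x. x + k) R"
  by (simp add: glue_def glue_lengths)

lemma glue_left_bounds: "x \<in> set L \<Longrightarrow> 0 < x \<and> x \<le> k"
  using L by (auto simp: Av231_iff in_perms_iff)

lemma glue_right_bounds0: "x \<in> set R \<Longrightarrow> 0 < x \<and> x \<le> l"
  using R by (auto simp: Av231_iff in_perms_iff)

lemma glue_right_bounds: "x \<in> set (map (\<lambda>x. x + k) R) \<Longrightarrow> k < x \<and> x \<le> k + l"
  using glue_right_bounds0 by auto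

lemma glue_last: "L \<noteq> [] \<Longrightarrow> 0 < last L \<and> last L \<le> k"
  by (intro glue_left_bounds) simp

lemma glue_filter_right:
  assumes "\<And>x. k < x \<Longrightarrow> x \<le> k + l \<Longrightarrow> P x"
  shows "length (filter P (map (\<lambda>x. x + k) R)) = l"
proof -
  have "filter P (map (\<lambda>x. x + k) R) = map (\<lambda>x. x + k) R"
    using assms glue_right_bounds by (intro filter_True) blast
  then show ?thesis by (simp add: glue_lengths)
qed

lemma glue_filter_right_none:
  assumes "\<And>x. k < x \<Longrightarrow> x \<le> k + l \<Longrightarrow> \<not> P x"
  shows "filter P (map (\<lambda>x. x + k) R) = []"
  using assms glue_right_bounds by (intro filter_False) blast

lemma asc_glue: "asc (glue L R) = asc L + of_bool (L \<noteq> []) + asc R"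
proof -
  have "asc (Suc (k + l) # map (\<lambda>x. x + k) R) = asc R"
    using glue_right_bounds[of "hd (map (\<lambda>x. x + k) R)"]
    unfolding adj_Cons[of _ "Suc (k + l)"] adj_map by (cases R) auto
  moreover have "asc (L @ [Suc (k + l)]) = asc L + of_bool (L \<noteq> [])"
    using le_imp_less_Suc[OF trans_le_add1[of "last L" k l]] glue_last
    by (cases "L = []") (simp_all add: adj_snoc)
  ultimately show ?thesis
    using adj_append[of "(<)" L "Suc (k + l)" "map (\<lambda>x. x + k) R"] unfolding glue_eq by linarith
qed

lemma v13_2_max_right: "v13_2 (Suc (k + l) # map (\<lambda>x. x + k) R) = v13_2 R"
proof (cases R)
  case (Cons a xs)
  then have "filter (\<lambda>c. Suc (k + l) < c \<and> c < a + k) (map (\<lambda>x. x + k) xs) = []"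
    using glue_right_bounds0 by (intro filter_False) force
  then have "v13_2 (Suc (k + l) # map (\<lambda>x. x + k) R) = v13_2 (map (\<lambda>x. x + k) R)"
    using Cons by simp
  then show ?thesis by (simp add: vinc_map)
qed auto

text \<open>The ascent from \<open>last L\<close> to the maximum encloses every letter of
  \<open>R\<close>; this is the source of the powers of \<open>q\<close> in the recurrence.\<close>

lemma v13_2_glue: "v13_2 (glue L R) = v13_2 L + (if L = [] then 0 else l) + v13_2 R"
proof -
  have "v13_2 (glue L R) = v13_2 L +
    (if L = [] then 0 else length (filter (\<lambda>c. last L < c \<and> c < Suc (k + l)) (map (\<lambda>x. x + k) R)))
    + v13_2 R"
    unfolding glue_eq v13_2_max_right[symmetric]
    by (rule vinc_append) (use glue_left_bounds glue_right_bounds in fastforce)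
  moreover have "length (filter (\<lambda>c. last L < c \<and> c < Suc (k + l)) (map (\<lambda>x. x + k) R)) = l"
    if "L \<noteq> []" using glue_last[OF that] by (intro glue_filter_right) auto
  ultimately show ?thesis by auto
qed

text \<open>The prepended 0 provides an ascent into the maximum even when \<open>L\<close> is empty,
  so the contribution \<open>l\<close> becomes unconditional.\<close>

lemma v13_2_zero_glue: "v13_2 (0 # glue L R) = v13_2 (0 # L) + l + v13_2 R"
proof -
  have "v13_2 ((0 # L) @ Suc (k + l) # map (\<lambda>x. x + k) R) = v13_2 (0 # L) +
    (if 0 # L = [] then 0 else
      length (filter (\<lambda>c. last (0 # L) < c \<and> c < Suc (k + l)) (map (\<lambda>x. x + k) R)))
    + v13_2 (Suc (k + l) # map (\<lambda>x. x + k) R)"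
    by (rule vinc_append) (use glue_left_bounds glue_right_bounds in fastforce)
  moreover have "length (filter (\<lambda>c. last (0 # L) < c \<and> c < Suc (k + l)) (map (\<lambda>x. x + k) R)) = l"
    using glue_last by (intro glue_filter_right) (auto split: if_splits)
  ultimately show ?thesis unfolding v13_2_max_right glue_eq by simp
qed

text \<open>The step into the maximum is an ascent and counts nothing, while the maximum followed by
  \<open>R\<close> is \<open>R\<close> with a largest letter prepended.\<close>

lemma v31_2_glue: "v31_2 (glue L R) = v31_2 L + v31_2 (Suc l # R)"
proof -
  have "v31_2 (glue L R) = v31_2 L +
    (if L = [] then 0 else length (filter (\<lambda>c. Suc (k + l) < c \<and> c < last L) (map (\<lambda>x. x + k) R)))
    + v31_2 (Suc (k + l) # map (\<lambda>x. x + k) R)"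
    unfolding glue_eq
    by (rule vinc_append) (use glue_left_bounds glue_right_bounds in fastforce)
  moreover have "filter (\<lambda>c. Suc (k + l) < c \<and> c < last L) (map (\<lambda>x. x + k) R) = []"
    by (intro glue_filter_right_none) auto
  moreover have "v31_2 (Suc (k + l) # map (\<lambda>x. x + k) R) = v31_2 (map (\<lambda>x. x + k) (Suc l # R))"
    by (simp add: add.commute)
  then have "v31_2 (Suc (k + l) # map (\<lambda>x. x + k) R) = v31_2 (Suc l # R)"
    unfolding vinc_map by simp
  ultimately show ?thesis by (auto split: if_splits)
qed

text \<open>The descent from the new letter into a nonempty \<open>L\<close> encloses the old
  maximum and all of \<open>R\<close>, which gives \<open>Suc l\<close>. If \<open>L\<close> is
  empty, it leads to the old maximum and encloses nothing.\<close>

lemma v31_2_max_glue: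
  "v31_2 (Suc (Suc (k + l)) # glue L R) =
    v31_2 (Suc k # L) + (if L = [] then 0 else Suc l) + v31_2 (Suc l # R)"
proof (cases L)
  case Nil
  then have "k = 0" using glue_lengths by simp
  moreover have "filter (\<lambda>c. Suc (k + l) < c \<and> c < Suc (Suc (k + l))) (map (\<lambda>x. x + k) R) = []"
    by (intro glue_filter_right_none) auto
  ultimately show ?thesis using v31_2_glue Nil unfolding glue_eq by simp
next
  case (Cons a xs)
  have "length (filter (\<lambda>c. a < c \<and> c < Suc (Suc (k + l))) (map (\<lambda>x. x + k) R)) = l"
    using glue_left_bounds[of a] Cons by (intro glue_filter_right) auto
  moreover have "filter (\<lambda>c. a < c \<and> c < Suc (Suc (k + l))) xs = filter (\<lambda>c. a < c \<and> c < Suc k) xs"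
    using glue_left_bounds Cons by (intro filter_cong) force+
  moreover have "a < Suc (k + l)" using glue_left_bounds[of a] Cons by simp
  moreover have "tl (glue L R) = xs @ Suc (k + l) # map (\<lambda>x. x + k) R"
    unfolding glue_eq by (simp add: Cons)
  ultimately have "length (filter (\<lambda>c. a < c \<and> c < Suc (Suc (k + l))) (tl (glue L R))) =
      length (filter (\<lambda>c. a < c \<and> c < Suc k) xs) + Suc l"
    by simp
  moreover have "v31_2 (Suc (Suc (k + l)) # glue L R) =
      length (filter (\<lambda>c. a < c \<and> c < Suc (Suc (k + l))) (tl (glue L R))) + v31_2 (glue L R)"
    unfolding vinc_Cons glue_eq by (simp add: Cons)
  ultimately show ?thesis using v31_2_glue Cons by simp
qed

lemma v31_2_rev_glue: "v31_2 (rev (glue L R)) = v31_2 (rev R) + v31_2 (Suc k # rev L)"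
proof -
  let ?R = "rev (map (\<lambda>x. x + k) R)"
  have "v31_2 (?R @ Suc (k + l) # rev L) = v31_2 ?R +
    (if ?R = [] then 0 else length (filter (\<lambda>c. Suc (k + l) < c \<and> c < last ?R) (rev L)))
    + v31_2 (Suc (k + l) # rev L)"
    by (rule vinc_append) (use glue_left_bounds glue_right_bounds in fastforce)
  moreover have "filter (\<lambda>c. Suc (k + l) < c \<and> c < last ?R) (rev L) = []"
    using glue_left_bounds by (intro filter_False) force
  moreover have "v31_2 (Suc (k + l) # rev L) = v31_2 (Suc k # rev L)"
    using glue_left_bounds by (intro v31_2_Cons_big) force+
  moreover have "v31_2 ?R = v31_2 (rev R)" unfolding rev_map vinc_map by simp
  ultimately show ?thesis unfolding glue_eq by (auto split: if_splits)
qed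

text \<open>Here the descent from the new letter enters the reversed \<open>R\<close>. Beyond that
  block it encloses only the old maximum, since the letters of \<open>L\<close> are too small; hence
  a single extra unit instead of a length.\<close>

lemma v31_2_max_rev_glue:
  "v31_2 (Suc (Suc (k + l)) # rev (glue L R)) =
    v31_2 (Suc l # rev R) + of_bool (R \<noteq> []) + v31_2 (Suc k # rev L)"
proof (cases "rev R")
  case Nil
  moreover have "filter (\<lambda>c. Suc (k + l) < c \<and> c < Suc (Suc (k + l))) (rev L) = []"
    using glue_left_bounds by (intro filter_False) force
  ultimately show ?thesis using v31_2_rev_glue unfolding glue_eq by simp
next
  case (Cons a xs)
  have xs: "x \<in> set xs \<Longrightarrow> x \<le> l" for x
    using glue_right_bounds0[of x] Cons by (metis list.set_intros(2) set_rev)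
  have a: "a \<in> set R" using Cons by (metis list.set_intros(1) set_rev)
  have "filter (\<lambda>c. a + k < c \<and> c < Suc (Suc (k + l))) (rev L) = []"
    using glue_left_bounds by (intro filter_False) force
  moreover have "filter (\<lambda>c. a + k < c \<and> c < Suc (Suc (k + l))) (map (\<lambda>x. x + k) xs) =
      map (\<lambda>x. x + k) (filter (\<lambda>c. a < c \<and> c < Suc l) xs)"
    unfolding filter_map comp_def using xs by (intro arg_cong[of _ _ "map _"] filter_cong) force+
  moreover have "a + k < Suc (k + l)" using glue_right_bounds0[OF a] by simp
  ultimately have "length (filter (\<lambda>c. a + k < c \<and> c < Suc (Suc (k + l))) (tl (rev (glue L R)))) =
      length (filter (\<lambda>c. a < c \<and> c < Suc l) xs) + 1"
    unfolding glue_eq by (simp add: rev_map Cons)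
  moreover have "v31_2 (Suc (Suc (k + l)) # rev (glue L R)) =
      length (filter (\<lambda>c. a + k < c \<and> c < Suc (Suc (k + l))) (tl (rev (glue L R)))) + v31_2 (rev (glue L R))"
    unfolding vinc_Cons by (simp add: glue_eq rev_map Cons)
  moreover have "R \<noteq> []" using Cons by auto
  ultimately show ?thesis using v31_2_rev_glue Cons by simp
qed

text \<open>The maximum sits at position \<open>k\<close> counted from 0 and must be a peak. The
  block \<open>R\<close> then starts at the even position \<open>Suc k\<close>, so its up-down
  pattern is unshifted. The one-letter word has its maximum at position 0 and is excluded.\<close>

lemma alternating_glue:
  assumes "0 < k + l"
  shows "alternating (glue L R) \<longleftrightarrow> odd k \<and> alternating L \<and> alternating R"
proof
  assume A: "alternating (glue L R)"
  have up: "glue L R ! i < glue L R ! Suc i" if "even i" "i < k + l" for i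
    using A that unfolding alternating_def glue_eq by (auto simp: glue_lengths)
  have down: "glue L R ! i > glue L R ! Suc i" if "odd i" "i < k + l" for i
    using A that unfolding alternating_def glue_eq by (auto simp: glue_lengths)
  have m: "glue L R ! k = Suc (k + l)" by (simp add: glue_eq nth_append glue_lengths)
  have nR: "glue L R ! (Suc k + i) = R ! i + k" if "i < l" for i
    using that by (simp add: glue_eq nth_append glue_lengths)
  have nL: "glue L R ! i = L ! i" if "i < k" for i
    using that by (simp add: glue_eq nth_append glue_lengths)
  \<comment> \<open>At an even position the maximum would have to lie below its right neighbour or,
    at the end of the word, below its left neighbour.\<close>
  have odd: "odd k"
  proof
    assume "even k"
    show False
    proof (cases "l = 0")
      case True
      with assms have "k \<noteq> 0" by simp
      with \<open>even k\<close> have "glue L R ! (k - 1) > glue L R ! Suc (k - 1)"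
        by (intro down) auto
      moreover have "glue L R ! (k - 1) \<le> k"
        using \<open>k \<noteq> 0\<close> nL[of "k - 1"] glue_left_bounds[of "L ! (k - 1)"] glue_lengths by simp
      ultimately show False using m \<open>k \<noteq> 0\<close> by simp
    next
      case False
      then have "glue L R ! k < glue L R ! Suc k" using \<open>even k\<close> by (intro up) auto
      then show False using m nR[of 0] False glue_right_bounds0[of "R ! 0"] glue_lengths by simp
    qed
  qed
  moreover have "alternating L"
    unfolding alternating_def glue_lengths
    using up down nL by (metis Suc_lessD trans_less_add1)
  moreover have "alternating R"
    unfolding alternating_def glue_lengths
  proof (intro allI impI)
    fix i assume i: "Suc i < l"
    have "even i \<Longrightarrow> glue L R ! (Suc k + i) < glue L R ! Suc (Suc k + i)"
      using i odd by (intro up) auto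
    moreover have "odd i \<Longrightarrow> glue L R ! (Suc k + i) > glue L R ! Suc (Suc k + i)"
      using i odd by (intro down) auto
    ultimately show "(even i \<longrightarrow> R ! i < R ! Suc i) \<and> (odd i \<longrightarrow> R ! Suc i < R ! i)"
      using i nR[of i] nR[of "Suc i"] by auto
  qed
  ultimately show "odd k \<and> alternating L \<and> alternating R" by blast
next
  assume A: "odd k \<and> alternating L \<and> alternating R"
  show "alternating (glue L R)"
    unfolding alternating_def
  proof (intro allI impI)
    fix i assume i: "Suc i < length (glue L R)"
    consider "Suc i < k" | "Suc i = k" | "i = k" | "k < i" by linarith
    then show "(even i \<longrightarrow> glue L R ! i < glue L R ! Suc i) \<and>
      (odd i \<longrightarrow> glue L R ! Suc i < glue L R ! i)"
    proof cases
      case 1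
      then show ?thesis using A by (simp add: glue_eq nth_append glue_lengths alternating_def)
    next
      case 2
      then have "L ! i \<in> set L" using glue_lengths by simp
      with 2 show ?thesis using A glue_left_bounds[of "L ! i"]
        by (auto simp: glue_eq nth_append glue_lengths)
    next
      case 3
      then have "R ! 0 \<in> set R" using i glue_lengths by (simp add: glue_eq)
      with 3 show ?thesis using A glue_right_bounds0[of "R ! 0"] i
        by (auto simp: glue_eq nth_append glue_lengths)
    next
      case 4
      then obtain j where j: "i = Suc (k + j)" using less_iff_Suc_add by auto
      then show ?thesis using A i
        by (auto simp: glue_eq nth_append glue_lengths alternating_def)
    qed
  qed
qed

end

section \<open>Coderangements\<close>

text \<open>The letter n+1 that is imagined behind the word is replaced by the demand that a
  left-to-right maximum is never last. This form makes sense for blocks that are not permutations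
  and survives shifting the letters.\<close>

definition no_foremax :: "nat list \<Rightarrow> bool" where
  "no_foremax p \<longleftrightarrow>
    (\<forall>i<length p. (\<forall>j\<le>i. p ! j \<le> p ! i) \<longrightarrow> Suc i < length p \<and> p ! Suc i \<le> p ! i)"

lemma coderangement_iff_no_foremax:
  assumes "p \<in> perms n"
  shows "coderangement p \<longleftrightarrow> no_foremax p"
proof -
  \<comment> \<open>The value that \<open>ext\<close> assigns behind the word exceeds every letter,
    so a left-to-right maximum in last position is always a foremaximum.\<close>
  have "p ! i < Suc (length p)" if "i < length p" for i
    using that assms length_perms[OF assms] nth_mem[OF that] by (auto simp: in_perms_iff)
  then show ?thesis
    unfolding coderangement_def no_foremax_def foremax_def ext_def by fastforce
qed

text \<open>The left-to-right maxima are those of \<open>xs\<close> together with \<open>m\<close>.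
  One at the end of \<open>xs\<close> would be followed by the larger \<open>m\<close>, which
  matches the ban on a final one in \<open>no_foremax xs\<close>; and \<open>m\<close> itself needs
  a successor.\<close>

lemma no_foremax_append_max:
  assumes "\<And>x. x \<in> set xs \<Longrightarrow> x < m" "\<And>x. x \<in> set ys \<Longrightarrow> x < m"
  shows "no_foremax (xs @ m # ys) \<longleftrightarrow> no_foremax xs \<and> ys \<noteq> []"
proof
  let ?p = "xs @ m # ys"
  have xs: "xs ! i < m" if "i < length xs" for i using assms(1) that by simp
  have ys: "ys ! i < m" if "i < length ys" for i using assms(2) that by simp
  {
    assume A: "no_foremax ?p"
    then have "Suc (length xs) < length ?p"
      unfolding no_foremax_def using xs
      by (elim allE[of _ "length xs"]) (auto simp: nth_append less_imp_le)
    moreover have "no_foremax xs"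
      unfolding no_foremax_def
    proof (intro allI impI)
      fix i assume i: "i < length xs" and m: "\<forall>j\<le>i. xs ! j \<le> xs ! i"
      have "\<forall>j\<le>i. ?p ! j \<le> ?p ! i" using i m by (simp add: nth_append)
      then have le: "?p ! Suc i \<le> ?p ! i" using A i unfolding no_foremax_def by simp
      have "Suc i < length xs"
      proof (rule ccontr)
        assume "\<not> Suc i < length xs"
        then have "Suc i = length xs" using i by simp
        then show False using le xs[OF i] by (simp add: nth_append)
      qed
      then show "Suc i < length xs \<and> xs ! Suc i \<le> xs ! i" using le by (simp add: nth_append)
    qed
    ultimately show "no_foremax xs \<and> ys \<noteq> []" by auto
  }
  {
    assume A: "no_foremax xs \<and> ys \<noteq> []"
    show "no_foremax ?p"
      unfolding no_foremax_def
    proof (intro allI impI)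
      fix i assume i: "i < length ?p" and m: "\<forall>j\<le>i. ?p ! j \<le> ?p ! i"
      consider "i < length xs" | "i = length xs" | "length xs < i" by linarith
      then show "Suc i < length ?p \<and> ?p ! Suc i \<le> ?p ! i"
      proof cases
        case 1
        then have "\<forall>j\<le>i. xs ! j \<le> xs ! i" using m by (auto simp: nth_append split: if_splits)
        then have "Suc i < length xs \<and> xs ! Suc i \<le> xs ! i"
          using A 1 unfolding no_foremax_def by simp
        then show ?thesis by (simp add: nth_append)
      next
        case 2
        then show ?thesis using A ys[of 0] by (simp add: nth_append)
      next
        case 3
        then obtain j where j: "i = Suc (length xs + j)" using less_iff_Suc_add by auto
        have "?p ! length xs \<le> ?p ! i" using m 3 by (meson less_imp_le)
        then show ?thesis using j i ys[of j] by (simp add: nth_append)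
      qed
    qed
  }
qed

lemma coderangement_rev_glue:
  assumes L: "L \<in> Av231 k" and R: "R \<in> Av231 l"
  shows "coderangement (rev (glue L R)) \<longleftrightarrow> L \<noteq> [] \<and> coderangement (rev R)"
proof -
  have "no_foremax (rev (map (\<lambda>x. x + k) R)) \<longleftrightarrow> no_foremax (rev R)"
    by (auto simp: no_foremax_def rev_map)
  moreover have "no_foremax (rev (map (\<lambda>x. x + k) R) @ Suc (k + l) # rev L) \<longleftrightarrow>
      no_foremax (rev (map (\<lambda>x. x + k) R)) \<and> rev L \<noteq> []"
    using glue_left_bounds[OF L R] glue_right_bounds[OF L R]
    by (intro no_foremax_append_max) force+
  moreover have "coderangement (rev R) \<longleftrightarrow> no_foremax (rev R)"
    using R by (intro coderangement_iff_no_foremax) (auto simp: Av231_iff)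
  moreover have "coderangement (rev (glue L R)) \<longleftrightarrow> no_foremax (rev (glue L R))"
    using glue_Av231[OF L R] by (intro coderangement_iff_no_foremax) (auto simp: Av231_iff)
  ultimately show ?thesis by (auto simp: glue_eq[OF L R])
qed

section \<open>The Carlitz--Riordan recurrence\<close>

text \<open>The dilation F(z) to F(qz).\<close>

definition dil :: "'a::comm_ring_1 \<Rightarrow> 'a fps \<Rightarrow> 'a fps" where
  "dil q F = Abs_fps (\<lambda>n. q ^ n * fps_nth F n)"

lemma dil_nth [simp]: "fps_nth (dil q F) n = q ^ n * fps_nth F n"
  by (simp add: dil_def)

lemma dil_add: "dil q (F + G) = dil q F + dil q G"
  by (simp add: fps_eq_iff algebra_simps)

lemma dil_diff: "dil q (F - G) = dil q F - dil q G"
  by (simp add: fps_eq_iff algebra_simps)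

lemma dil_const: "dil q (fps_const c) = fps_const c"
  by (simp add: fps_eq_iff)

lemma dil_1: "dil q 1 = 1"
  by (simp add: fps_eq_iff)

lemma dil_X: "dil q fps_X = fps_const q * fps_X"
  by (simp add: fps_eq_iff fps_X_def)

lemma dil_mult: "dil q (F * G) = dil q F * dil q G"
proof (rule fps_ext)
  fix n
  have "q ^ n * (fps_nth F i * fps_nth G (n - i)) = q ^ i * fps_nth F i * (q ^ (n - i) * fps_nth G (n - i))"
    if "i \<le> n" for i
  proof -
    have "q ^ n = q ^ i * q ^ (n - i)" using that by (simp flip: power_add)
    then show ?thesis by (simp add: ac_simps)
  qed
  then show "fps_nth (dil q (F * G)) n = fps_nth (dil q F * dil q G) n"
    by (simp add: fps_mult_nth sum_distrib_left)
qed

lemmas dil_simps = dil_add dil_diff dil_const dil_1 dil_X dil_mult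

lemma dil_inverse:
  fixes F :: "'a::field fps"
  assumes "fps_nth F 0 \<noteq> 0"
  shows "dil q (inverse F) = inverse (dil q F)"
proof (rule fps_inverse_unique[symmetric])
  have "F * inverse F = 1" using assms by (rule inverse_mult_eq_1')
  then show "dil q F * dil q (inverse F) = 1" by (simp flip: dil_mult add: dil_1)
qed

section \<open>The continued fraction as a functional equation\<close>

lemma cat_weight_carlitz:
  assumes "0 < j"
  shows "cat_weight Q (Q\<^sup>2) j = Q ^ (j - 1)"
proof (cases "odd j")
  case True
  then have "2 * ((j - 1) div 2) = j - 1" by presburger
  with True show ?thesis by (simp add: cat_weight_def flip: power_mult)
next
  case False
  then have "Suc (2 * (j div 2 - 1)) = j - 1" using assms by presburger
  then have "Q * (Q\<^sup>2) ^ (j div 2 - 1) = Q ^ (j - 1)" by (metis power_Suc power_mult)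
  with False show ?thesis by (simp add: cat_weight_def)
qed

text \<open>Starting one level deeper multiplies every weight by \<open>Q\<close>, which has the
  same effect as replacing z by Qz.\<close>

lemma sfrac_trunc_shift:
  fixes Q :: "'a::field"
  assumes "0 < k"
  shows "sfrac_trunc (cat_weight Q (Q\<^sup>2)) (Suc k) d = dil Q (sfrac_trunc (cat_weight Q (Q\<^sup>2)) k d)"
  using assms
proof (induction d arbitrary: k)
  case (Suc d)
  have "cat_weight Q (Q\<^sup>2) (Suc k) = Q * cat_weight Q (Q\<^sup>2) k"
    using Suc.prems by (cases k) (simp_all add: cat_weight_carlitz)
  with Suc show ?case
    by (simp add: dil_inverse dil_simps ac_simps flip: fps_const_mult)
qed (simp add: dil_1)

lemma sfrac_trunc_nth:
  fixes Q :: "'a::field"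
  defines "T \<equiv> sfrac_trunc (cat_weight Q (Q\<^sup>2)) 1"
  shows "fps_nth (T d) 0 = 1"
    and "fps_nth (T (Suc d)) (Suc n) =
      (\<Sum>k\<le>n. Q ^ (n - k) * fps_nth (T (Suc d)) k * fps_nth (T d) (n - k))"
proof -
  have T0: "fps_nth (T d) 0 = 1" for d
    unfolding T_def by (cases d) auto
  show "fps_nth (T d) 0 = 1" by (rule T0)
  have "T (Suc d) = inverse (1 - fps_X * dil Q (T d))"
    unfolding T_def sfrac_trunc.simps sfrac_trunc_shift[OF zero_less_one]
      cat_weight_carlitz[OF zero_less_one] by simp
  moreover have "fps_nth (1 - fps_X * dil Q (T d)) 0 \<noteq> 0" by simp
  ultimately have "T (Suc d) * (1 - fps_X * dil Q (T d)) = 1"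
    by (metis inverse_mult_eq_1)
  then have "T (Suc d) = 1 + fps_X * (T (Suc d) * dil Q (T d))"
    by (simp add: algebra_simps)
  then have "fps_nth (T (Suc d)) (Suc n) = fps_nth (1 + fps_X * (T (Suc d) * dil Q (T d))) (Suc n)"
    by (rule arg_cong)
  also have "\<dots> = fps_nth (T (Suc d) * dil Q (T d)) n" by simp
  also have "\<dots> = (\<Sum>k\<le>n. Q ^ (n - k) * fps_nth (T (Suc d)) k * fps_nth (T d) (n - k))"
    by (simp add: fps_mult_nth atMost_atLeast0 ac_simps)
  finally show "fps_nth (T (Suc d)) (Suc n) = \<dots>" .
qed

text \<open>Coefficient \<open>m + 1\<close> at depth \<open>e + 1\<close> involves only
  coefficients up to \<open>m\<close> at the depths \<open>e + 1\<close> and \<open>e\<close>, so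
  induction on the coefficient works with both depths varying.\<close>

lemma sfrac_trunc_stable:
  fixes Q :: "'a::field"
  shows "n \<le> d \<Longrightarrow> n \<le> d' \<Longrightarrow> fps_nth (sfrac_trunc (cat_weight Q (Q\<^sup>2)) 1 d) n =
    fps_nth (sfrac_trunc (cat_weight Q (Q\<^sup>2)) 1 d') n"
proof (induction n arbitrary: d d' rule: less_induct)
  case (less n)
  show ?case
  proof (cases n)
    case 0
    then show ?thesis by (simp only: sfrac_trunc_nth)
  next
    case (Suc m)
    then obtain e e' where e: "d = Suc e" "d' = Suc e'" "m \<le> e" "m \<le> e'"
      using less.prems by (metis Suc_le_D Suc_le_mono)
    then show ?thesis
      unfolding Suc e sfrac_trunc_nth
      by (intro sum.cong arg_cong2[of _ _ _ _ "(*)"] refl less.IH) (auto simp: Suc)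
  qed
qed

lemma Cq_0: "Cq 0 Q = 1"
  by (simp add: Cq_def Ctq_def sfrac_def)

lemma Cq_Suc: "Cq (Suc n) Q = (\<Sum>k\<le>n. Q ^ (n - k) * Cq k Q * Cq (n - k) Q)"
proof -
  have Cq: "Cq m Q = fps_nth (sfrac_trunc (cat_weight Q (Q\<^sup>2)) 1 d) m" if "m \<le> d" for m d
    using sfrac_trunc_stable[of m "Suc m" d Q] that by (simp add: Cq_def Ctq_def sfrac_def)
  have "Cq (Suc n) Q = fps_nth (sfrac_trunc (cat_weight Q (Q\<^sup>2)) 1 (Suc (Suc n))) (Suc n)"
    by (rule Cq) simp
  also have "\<dots> = (\<Sum>k\<le>n. Q ^ (n - k) * Cq k Q * Cq (n - k) Q)"
    unfolding sfrac_trunc_nth(2)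
    by (intro sum.cong refl arg_cong2[of _ _ _ _ "(*)"] Cq[symmetric]) auto
  finally show ?thesis .
qed

section \<open>Sequences supported on one parity\<close>

text \<open>A product of two odd-indexed terms loses one power of \<open>y\<close>, which the
  prefactor restores; \<open>b\<close> is the part of the prefactor shared with \<open>a\<close>.
  The recurrence for \<open>a\<close> is compared at odd indices only, because at even ones an
  alternating sum need not vanish while \<open>g\<close> does.\<close>

lemma signed_odd_sequence:
  fixes g a :: "nat \<Rightarrow> 'a::comm_ring_1"
  assumes g0: "g 0 = 0"
    and g: "\<And>n. g (Suc n) = of_bool (n = 0) + y * b * (\<Sum>k\<le>n. Q ^ (n - k) * g k * g (n - k))"
    and a1: "a 1 = 1"
    and a: "\<And>n. even n \<Longrightarrow> 0 < n \<Longrightarrow>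
      a (Suc n) = b * (\<Sum>k\<le>n. if odd k then Q ^ (n - k) * a k * a (n - k) else 0)"
  shows "g n = (if odd n then y ^ (n div 2) * a n else 0)"
proof (induction n rule: less_induct)
  case (less n)
  consider "n = 0" | "n = 1" | m where "n = Suc m" "odd m" | m where "n = Suc m" "even m" "0 < m"
    by (cases n) auto
  then show ?case
  proof cases
    case 1
    then show ?thesis by (simp add: g0)
  next
    case 2
    then show ?thesis using g[of 0] a1 by (simp add: g0)
  next
    case (3 m)
    have "(\<Sum>k\<le>m. Q ^ (m - k) * g k * g (m - k)) = 0"
    proof (intro sum.neutral ballI)
      fix k assume "k \<in> {..m}"
      then have "even k \<or> even (m - k)" "k < n" "m - k < n" using 3 by auto
      then show "Q ^ (m - k) * g k * g (m - k) = 0" using less by auto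
    qed
    moreover have "m \<noteq> 0" using 3 by (cases m) auto
    ultimately show ?thesis using g[of m] 3 by simp
  next
    case (4 m)
    have "(\<Sum>k\<le>m. Q ^ (m - k) * g k * g (m - k)) =
      (\<Sum>k\<le>m. y ^ (m div 2 - 1) * (if odd k then Q ^ (m - k) * a k * a (m - k) else 0))"
    proof (intro sum.cong refl)
      fix k assume k: "k \<in> {..m}"
      show "Q ^ (m - k) * g k * g (m - k) =
        y ^ (m div 2 - 1) * (if odd k then Q ^ (m - k) * a k * a (m - k) else 0)"
      proof (cases "odd k")
        case True
        then have o: "odd (m - k)" using k 4 by auto
        obtain i j where ij: "k = 2 * i + 1" "m - k = 2 * j + 1" using True o by (meson oddE)
        \<comment> \<open>The halves of \<open>k\<close> and \<open>m - k\<close> sum to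
          \<open>m div 2 - 1\<close>; the factor \<open>y\<close> in the recurrence supplies the
          missing power.\<close>
        then have "m = 2 * (i + j + 1)" using k by auto
        then have "k div 2 + (m - k) div 2 = m div 2 - 1" using ij by simp
        then have "y ^ (m div 2 - 1) = y ^ (k div 2) * y ^ ((m - k) div 2)"
          by (metis power_add)
        moreover have "k < n" "m - k < n" using k 4 by auto
        ultimately show ?thesis using True o less by (simp add: ac_simps)
      next
        case False
        then show ?thesis using less[of k] k 4 by simp
      qed
    qed
    then have "g n = y * y ^ (m div 2 - 1) * a n"
      using g[of m] a[of m] 4 by (simp add: sum_distrib_left[symmetric] ac_simps)
    moreover have "y * y ^ (m div 2 - 1) = y ^ (n div 2)"
      using 4 by (auto elim!: evenE simp flip: power_Suc)
    ultimately show ?thesis using 4 by simp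
  qed
qed

lemma signed_even_sequence:
  fixes g d a e :: "nat \<Rightarrow> 'a::comm_ring_1"
  assumes g: "\<And>n. 0 < n \<Longrightarrow> g n = (if odd n then y ^ (n div 2) * a n else 0)"
    and d0: "d 0 = 1"
    and d: "\<And>n. d (Suc n) = (\<Sum>k\<le>n. (if k = 0 then 0 else y * Q ^ (n - k)) * g k * d (n - k))"
    and e0: "e 0 = 1"
    and e: "\<And>n. odd n \<Longrightarrow>
      e (Suc n) = (\<Sum>k\<le>n. if odd k then Q ^ (n - k) * a k * e (n - k) else 0)"
  shows "d n = (if even n then y ^ (n div 2) * e n else 0)"
proof (induction n rule: less_induct)
  case (less n)
  consider "n = 0" | m where "n = Suc m" "odd m" | m where "n = Suc m" "even m"
    by (cases n) auto
  then show ?case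
  proof cases
    case 1
    then show ?thesis by (simp add: d0 e0)
  next
    case (2 m)
    have "(\<Sum>k\<le>m. (if k = 0 then 0 else y * Q ^ (m - k)) * g k * d (m - k)) =
      (\<Sum>k\<le>m. y ^ (n div 2) * (if odd k then Q ^ (m - k) * a k * e (m - k) else 0))"
    proof (intro sum.cong refl)
      fix k assume k: "k \<in> {..m}"
      show "(if k = 0 then 0 else y * Q ^ (m - k)) * g k * d (m - k) =
        y ^ (n div 2) * (if odd k then Q ^ (m - k) * a k * e (m - k) else 0)"
      proof (cases "odd k")
        case True
        then have ev: "even (m - k)" using k 2 by auto
        obtain i j where ij: "k = 2 * i + 1" "m - k = 2 * j" using True ev by (meson oddE evenE)
        then have "m = 2 * (i + j) + 1" using k by auto
        then have "k div 2 + (m - k) div 2 = m div 2" using ij by simp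
        then have "y ^ (m div 2) = y ^ (k div 2) * y ^ ((m - k) div 2)"
          by (metis power_add)
        moreover have "n div 2 = Suc (m div 2)" using 2 by simp
        moreover have "m - k < n" "0 < k" using True k 2 by (auto intro: Nat.gr0I)
        ultimately show ?thesis using True ev g[of k] less[of "m - k"] by (simp add: ac_simps)
      next
        case False
        then show ?thesis using g[of k] by simp
      qed
    qed
    then show ?thesis using d[of m] e[of m] 2 by (simp add: sum_distrib_left[symmetric])
  next
    case (3 m)
    have "(\<Sum>k\<le>m. (if k = 0 then 0 else y * Q ^ (m - k)) * g k * d (m - k)) = 0"
    proof (intro sum.neutral ballI)
      fix k assume k: "k \<in> {..m}"
      then have "even k \<or> odd (m - k)" "m - k < n" using 3 by auto
      then show "(if k = 0 then 0 else y * Q ^ (m - k)) * g k * d (m - k) = 0"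
        using g[of k] less[of "m - k"] by auto
    qed
    then show ?thesis using d[of m] 3 by simp
  qed
qed

lemma sum_odd_indices:
  "(\<Sum>k\<le>2 * m. if odd k then f k else 0) = (\<Sum>i<m. f (Suc (2 * i)))"
  for f :: "nat \<Rightarrow> 'a::comm_monoid_add"
  by (induction m) (simp_all add: add.commute)

text \<open>With F(w) = 1 + w F(w) F(q^2 w), the series G(z) = z F(-c q z^2) solves G(z) = z - c z
  G(z) G(qz): the dilation z to qz multiplies w = -c q z^2 by q^2, and the factor z of G(qz) yields
  the extra q.\<close>

lemma odd_sequence_eq_Cq:
  fixes g :: "nat \<Rightarrow> 'a::field"
  assumes g0: "g 0 = 0"
    and g: "\<And>n. g (Suc n) = of_bool (n = 0) - c * (\<Sum>k\<le>n. q ^ (n - k) * g k * g (n - k))"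
  shows "g n = (if odd n then (- (c * q)) ^ (n div 2) * Cq (n div 2) (q\<^sup>2) else 0)"
proof -
  define a where "a n = q ^ (n div 2) * Cq (n div 2) (q\<^sup>2)" for n
  have "g n = (if odd n then (- c) ^ (n div 2) * a n else 0)"
  proof (rule signed_odd_sequence[where b = 1 and Q = q])
    show "a 1 = 1" by (simp add: a_def Cq_0)
    fix n :: nat assume "even n" "0 < n"
    then have "n = 2 * Suc (n div 2 - 1)" by presburger
    then obtain m where n: "n = 2 * Suc m" ..
    have "(\<Sum>k\<le>n. if odd k then q ^ (n - k) * a k * a (n - k) else 0) =
      (\<Sum>i<Suc m. q ^ (n - Suc (2 * i)) * a (Suc (2 * i)) * a (n - Suc (2 * i)))"
      unfolding n by (rule sum_odd_indices)
    also have "\<dots> = (\<Sum>i\<le>m. q ^ Suc m * ((q\<^sup>2) ^ (m - i) * Cq i (q\<^sup>2) * Cq (m - i) (q\<^sup>2)))"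
      unfolding lessThan_Suc_atMost
    proof (intro sum.cong refl)
      fix i assume "i \<in> {..m}"
      then obtain j where m: "m = i + j" using le_iff_add by auto
      \<comment> \<open>The exponent is 3j + i + 1 = (m + 1) + 2j. The power
        \<open>q ^ Suc m\<close> is the one in \<open>a (Suc n)\<close>, and the rest is the
        Carlitz-Riordan weight with parameter \<open>q\<^sup>2\<close>.\<close>
      have "q ^ Suc (2 * j) * q ^ i * q ^ j = q ^ Suc m * (q\<^sup>2) ^ j"
        unfolding m power_mult[symmetric] power_add[symmetric] by (simp add: algebra_simps)
      moreover have "n - Suc (2 * i) = Suc (2 * j)" using n m by simp
      ultimately show "q ^ (n - Suc (2 * i)) * a (Suc (2 * i)) * a (n - Suc (2 * i)) =
          q ^ Suc m * ((q\<^sup>2) ^ (m - i) * Cq i (q\<^sup>2) * Cq (m - i) (q\<^sup>2))"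
        using m by (simp add: a_def) (metis (no_types, opaque_lifting) mult.assoc mult.commute)
    qed
    also have "\<dots> = a (Suc n)"
      by (simp add: a_def n Cq_Suc sum_distrib_left[symmetric])
    finally show "a (Suc n) = 1 * (\<Sum>k\<le>n. if odd k then q ^ (n - k) * a k * a (n - k) else 0)"
      by simp
  qed (use g0 g in simp_all)
  moreover have "(- c) ^ (n div 2) * a n = (- (c * q)) ^ (n div 2) * Cq (n div 2) (q\<^sup>2)"
    unfolding a_def by (simp add: power_mult_distrib[symmetric] flip: mult.assoc)
  ultimately show ?thesis by simp
qed

section \<open>Elimination of the auxiliary series\<close>

lemma fps_nth_recurrence:
  assumes G: "G = fps_X - fps_const c * (fps_X * (G * dil q G))"
  shows "fps_nth G 0 = 0"
    and "fps_nth G (Suc n) = of_bool (n = 0) -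
      c * (\<Sum>k\<le>n. q ^ (n - k) * fps_nth G k * fps_nth G (n - k))"
proof -
  have *: "fps_nth G m = fps_nth (fps_X - fps_const c * (fps_X * (G * dil q G))) m" for m
    using G by (rule arg_cong)
  show "fps_nth G 0 = 0" using *[of 0] by simp
  have "fps_nth G (Suc n) = of_bool (n = 0) - c * fps_nth (G * dil q G) n"
    using *[of "Suc n"] by simp
  then show "fps_nth G (Suc n) = of_bool (n = 0) -
      c * (\<Sum>k\<le>n. q ^ (n - k) * fps_nth G k * fps_nth G (n - k))"
    by (simp add: fps_mult_nth atMost_atLeast0 ac_simps)
qed

text \<open>The recurrences say G = z (1 - G) H and H = 1 + z (H - q (H - 1) H(qz)). The first makes
  1 + z H the inverse of 1 - G, and its dilated form linearises the second.\<close>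

lemma eliminate_max_series:
  fixes r h :: "nat \<Rightarrow> 'a::comm_ring_1"
  assumes r0: "r 0 = 1" and h0: "h 0 = 1"
    and r: "\<And>n. r (Suc n) = (\<Sum>k\<le>n. (if k = 0 then 1 else - 1) * r k * h (n - k))"
    and h: "\<And>n. h (Suc n) = (\<Sum>k\<le>n. (if k = 0 then 1 else - q * q ^ (n - k)) * h k * h (n - k))"
  defines "G \<equiv> Abs_fps r - 1"
  shows "G = fps_X - fps_const 1 * (fps_X * (G * dil q G))"
proof -
  define H where "H = Abs_fps h"
  have G_nth: "fps_nth G k = (if k = 0 then 0 else r k)" for k by (simp add: G_def r0)
  have H_nth: "fps_nth H k = h k" for k by (simp add: H_def)
  have G1: "G = fps_X * ((1 - G) * H)"
  proof (rule fps_ext)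
    fix n show "fps_nth G n = fps_nth (fps_X * ((1 - G) * H)) n"
    proof (cases n)
      case (Suc m)
      have "fps_nth (fps_X * ((1 - G) * H)) n = (\<Sum>k\<le>m. fps_nth (1 - G) k * h (m - k))"
        by (simp add: Suc fps_mult_nth[of "1 - G"] atMost_atLeast0 H_nth)
      also have "\<dots> = (\<Sum>k\<le>m. (if k = 0 then 1 else - 1) * r k * h (m - k))"
        by (intro sum.cong refl) (auto simp: G_nth r0)
      finally show ?thesis using r[of m] by (simp add: G_nth Suc)
    qed (simp add: G_nth)
  qed
  have H1: "H = 1 + fps_X * (H - fps_const q * ((H - 1) * dil q H))"
  proof (rule fps_ext)
    fix n show "fps_nth H n = fps_nth (1 + fps_X * (H - fps_const q * ((H - 1) * dil q H))) n"
    proof (cases n)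
      case (Suc m)
      have "fps_nth (1 + fps_X * (H - fps_const q * ((H - 1) * dil q H))) n =
          h m - q * (\<Sum>k\<le>m. fps_nth (H - 1) k * (q ^ (m - k) * h (m - k)))"
        by (simp add: Suc fps_mult_nth[of "H - 1"] atMost_atLeast0 H_nth)
      also have "\<dots> = (\<Sum>k\<le>m. if k = 0 then h m else 0) +
          (\<Sum>k\<le>m. - q * (fps_nth (H - 1) k * (q ^ (m - k) * h (m - k))))"
        by (simp add: sum_distrib_left sum_negf)
      also have "\<dots> = (\<Sum>k\<le>m. (if k = 0 then 1 else - q * q ^ (m - k)) * h k * h (m - k))"
        unfolding sum.distrib[symmetric] by (intro sum.cong refl) (auto simp: H_nth h0)
      finally show ?thesis using h[of m] by (simp add: H_nth Suc)
    qed (simp add: H_nth h0)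
  qed
  have u: "(1 - G) * (1 + fps_X * H) = 1"
  proof -
    have "(1 - G) * (1 + fps_X * H) = 1 - G + fps_X * ((1 - G) * H)" by (simp add: algebra_simps)
    then show ?thesis by (simp flip: G1)
  qed
  then have "dil q ((1 - G) * (1 + fps_X * H)) = dil q 1" by simp
  then have v: "(1 - dil q G) * (1 + fps_const q * fps_X * dil q H) = 1"
    by (simp add: dil_simps)
  have "H * (1 + fps_const q * fps_X * dil q H - fps_X) = 1 + fps_const q * fps_X * dil q H"
  proof -
    have "H * (1 + fps_const q * fps_X * dil q H - fps_X) = 1 + fps_const q * fps_X * dil q H +
        (H - (1 + fps_X * (H - fps_const q * ((H - 1) * dil q H))))"
      by (simp add: algebra_simps)
    then show ?thesis by (simp flip: H1)
  qed
  then have w0: "(1 - dil q G) * (H * (1 + fps_const q * fps_X * dil q H - fps_X)) = 1"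
    using v by simp
  \<comment> \<open>Multiplying by \<open>1 - dil q G\<close> replaces the factor
    \<open>1 + fps_const q * fps_X * dil q H\<close> by 1, so \<open>H\<close> becomes an explicit
    inverse in terms of \<open>dil q G\<close>.\<close>
  have w: "H * (1 - fps_X * (1 - dil q G)) = 1"
  proof -
    have "(1 - dil q G) * (H * (1 + fps_const q * fps_X * dil q H - fps_X)) =
        H * ((1 - dil q G) * (1 + fps_const q * fps_X * dil q H)) - H * fps_X * (1 - dil q G)"
      by (simp add: algebra_simps)
    with w0 show ?thesis unfolding v by (simp add: algebra_simps)
  qed
  have "G * (1 - fps_X * (1 - dil q G)) = fps_X * (1 - G) * (H * (1 - fps_X * (1 - dil q G)))"
    using G1 by (metis mult.assoc)
  also have "\<dots> = fps_X * (1 - G)" unfolding w by simp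
  finally show ?thesis by (simp add: algebra_simps)
qed

text \<open>The auxiliary equation is that of \<open>eliminate_max_series\<close>, but
  \<open>K\<close> already involves S(qz): \<open>W\<close> is the inverse of
  \<open>1 - c * K\<close> with no dilation, S is solved for first, and only then is z replaced by
  qz. This is why the resulting constant is \<open>q\<^sup>2\<close>.\<close>

lemma eliminate_zero_series:
  fixes s t :: "nat \<Rightarrow> 'a::comm_ring_1"
  assumes s0: "s 0 = 1" and t0: "t 0 = 1"
    and s: "\<And>n. s (Suc n) = (\<Sum>k\<le>n. (if k = 0 then 1 else - q * q ^ (n - k)) * s k * s (n - k))"
    and t: "\<And>n. t (Suc n) = (\<Sum>k\<le>n. (if k = 0 then q ^ (n - k) else - q * q ^ (n - k)) * t k * s (n - k))"
  defines "K \<equiv> Abs_fps t - 1"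
  shows "K = fps_X - fps_const (q\<^sup>2) * (fps_X * (K * dil q K))"
proof -
  define S where "S = Abs_fps s"
  define c where "c = fps_const q"
  have K_nth: "fps_nth K k = (if k = 0 then 0 else t k)" for k by (simp add: K_def t0)
  have S_nth: "fps_nth S k = s k" for k by (simp add: S_def)
  have K1: "K = fps_X * ((1 - c * K) * dil q S)"
  proof (rule fps_ext)
    fix n show "fps_nth K n = fps_nth (fps_X * ((1 - c * K) * dil q S)) n"
    proof (cases n)
      case (Suc m)
      have "fps_nth (fps_X * ((1 - c * K) * dil q S)) n =
          (\<Sum>k\<le>m. fps_nth (1 - c * K) k * (q ^ (m - k) * s (m - k)))"
        by (simp add: Suc fps_mult_nth[of "1 - c * K"] atMost_atLeast0 S_nth)
      also have "\<dots> = (\<Sum>k\<le>m. (if k = 0 then q ^ (m - k) else - q * q ^ (m - k)) * t k * s (m - k))"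
        by (intro sum.cong refl) (auto simp: K_nth t0 c_def)
      finally show ?thesis using t[of m] by (simp add: K_nth Suc)
    qed (simp add: K_nth)
  qed
  have S1: "S = 1 + fps_X * (S - c * ((S - 1) * dil q S))"
  proof (rule fps_ext)
    fix n show "fps_nth S n = fps_nth (1 + fps_X * (S - c * ((S - 1) * dil q S))) n"
    proof (cases n)
      case (Suc m)
      have "fps_nth (1 + fps_X * (S - c * ((S - 1) * dil q S))) n =
          s m - q * (\<Sum>k\<le>m. fps_nth (S - 1) k * (q ^ (m - k) * s (m - k)))"
        by (simp add: Suc fps_mult_nth[of "S - 1"] atMost_atLeast0 S_nth c_def)
      also have "\<dots> = (\<Sum>k\<le>m. if k = 0 then s m else 0) +
          (\<Sum>k\<le>m. - q * (fps_nth (S - 1) k * (q ^ (m - k) * s (m - k))))"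
        by (simp add: sum_distrib_left sum_negf)
      also have "\<dots> = (\<Sum>k\<le>m. (if k = 0 then 1 else - q * q ^ (m - k)) * s k * s (m - k))"
        unfolding sum.distrib[symmetric] by (intro sum.cong refl) (auto simp: S_nth s0)
      finally show ?thesis using s[of m] by (simp add: S_nth Suc)
    qed (simp add: S_nth s0)
  qed
  define W where "W = 1 + c * fps_X * dil q S"
  have u: "(1 - c * K) * W = 1"
  proof -
    have "(1 - c * K) * W = 1 - c * K + c * (fps_X * ((1 - c * K) * dil q S))"
      by (simp add: W_def algebra_simps)
    then show ?thesis by (simp flip: K1)
  qed
  have "S * (W - fps_X) = W"
  proof -
    have "S * (W - fps_X) = W + (S - (1 + fps_X * (S - c * ((S - 1) * dil q S))))"
      by (simp add: W_def algebra_simps)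
    then show ?thesis by (simp flip: S1)
  qed
  then have "(1 - c * K) * (S * (W - fps_X)) = 1" by (simp add: u)
  moreover have "(1 - c * K) * (S * (W - fps_X)) = S * ((1 - c * K) * W) - S * fps_X * (1 - c * K)"
    by (simp add: algebra_simps)
  ultimately have "S * (1 - fps_X * (1 - c * K)) = 1"
    unfolding u by (simp add: algebra_simps)
  then have "dil q (S * (1 - fps_X * (1 - c * K))) = dil q 1" by simp
  then have v: "dil q S * (1 - c * fps_X * (1 - c * dil q K)) = 1"
    by (simp add: dil_simps c_def)
  have "K * (1 - c * fps_X * (1 - c * dil q K)) =
      fps_X * (1 - c * K) * (dil q S * (1 - c * fps_X * (1 - c * dil q K)))"
    using K1 by (metis mult.assoc)
  also have "\<dots> = fps_X * (1 - c * K)" unfolding v by simp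
  finally have "K = fps_X - c * c * (fps_X * (K * dil q K))" by (simp add: algebra_simps)
  then show ?thesis by (simp add: c_def power2_eq_square)
qed

section \<open>Recurrences for the weighted sums\<close>

lemma Av231_0: "Av231 0 = {[]}"
  by (auto simp: Av231_iff in_perms_iff has3_def)

text \<open>Every recurrence below comes from this rule: the weight of a glued word factors over the
  blocks, up to a coefficient depending only on lengths.\<close>

lemma sum_Av231_Suc_prod:
  fixes u v w :: "nat list \<Rightarrow> 'a::comm_semiring_1"
  assumes "\<And>k L R. k \<le> n \<Longrightarrow> L \<in> Av231 k \<Longrightarrow> R \<in> Av231 (n - k) \<Longrightarrow> w (glue L R) = c k * u L * v R"
  shows "(\<Sum>p\<in>Av231 (Suc n). w p) =
    (\<Sum>k\<le>n. c k * (\<Sum>L\<in>Av231 k. u L) * (\<Sum>R\<in>Av231 (n - k). v R))"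
proof -
  have "(\<Sum>p\<in>Av231 (Suc n). w p) = (\<Sum>k\<le>n. \<Sum>L\<in>Av231 k. \<Sum>R\<in>Av231 (n - k). c k * u L * v R)"
    unfolding sum_Av231_Suc using assms by (intro sum.cong refl) auto
  also have "\<dots> = (\<Sum>k\<le>n. c k * (\<Sum>L\<in>Av231 k. u L) * (\<Sum>R\<in>Av231 (n - k). v R))"
    by (simp only: mult.assoc sum_product) (simp only: sum_distrib_left)
  finally show ?thesis .
qed

lemma Av231_Nil_iff: "L \<in> Av231 k \<Longrightarrow> L = [] \<longleftrightarrow> k = 0"
  using length_perms[of L k] by (auto simp: Av231_iff)

text \<open>
  The sums are named \<open>S\<close> for the plain statistic, \<open>Z\<close> if a smallest letter is prepended, \<open>M\<close> if a largest
  one is; \<open>D\<close> restricts to reversed coderangements and \<open>A\<close> to alternating permutations. The letter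
  \<open>R\<close> means that the statistic is taken on the reversed word.
\<close>

definition S13 :: "'a::field \<Rightarrow> 'a \<Rightarrow> nat \<Rightarrow> 'a" where
  "S13 x q n = (\<Sum>p\<in>Av231 n. x ^ asc p * q ^ v13_2 p)"

definition Z13 :: "'a::field \<Rightarrow> 'a \<Rightarrow> nat \<Rightarrow> 'a" where
  "Z13 x q n = (\<Sum>p\<in>Av231 n. x ^ asc p * q ^ v13_2 (0 # p))"

definition S31 :: "'a::field \<Rightarrow> 'a \<Rightarrow> nat \<Rightarrow> 'a" where
  "S31 x q n = (\<Sum>p\<in>Av231 n. x ^ asc p * q ^ v31_2 p)"

definition M31 :: "'a::field \<Rightarrow> 'a \<Rightarrow> nat \<Rightarrow> 'a" where
  "M31 x q n = (\<Sum>p\<in>Av231 n. x ^ asc p * q ^ v31_2 (Suc (length p) # p))"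

definition MR31 :: "'a::field \<Rightarrow> 'a \<Rightarrow> nat \<Rightarrow> 'a" where
  "MR31 x q n = (\<Sum>p\<in>Av231 n. x ^ asc p * q ^ v31_2 (Suc (length p) # rev p))"

definition D13 :: "'a::field \<Rightarrow> 'a \<Rightarrow> nat \<Rightarrow> 'a" where
  "D13 x q n = (\<Sum>p\<in>Av231 n. of_bool (coderangement (rev p)) * x ^ asc p * q ^ v13_2 p)"

definition DR31 :: "'a::field \<Rightarrow> 'a \<Rightarrow> nat \<Rightarrow> 'a" where
  "DR31 x q n = (\<Sum>p\<in>Av231 n. of_bool (coderangement (rev p)) * x ^ asc p * q ^ v31_2 (rev p))"

definition A13 :: "'a::field \<Rightarrow> nat \<Rightarrow> 'a" where
  "A13 q n = (\<Sum>p\<in>Av231 n. of_bool (alternating p) * q ^ v13_2 p)"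

definition AR31 :: "'a::field \<Rightarrow> nat \<Rightarrow> 'a" where
  "AR31 q n = (\<Sum>p\<in>Av231 n. of_bool (alternating p) * q ^ v31_2 (rev p))"

definition AMR31 :: "'a::field \<Rightarrow> nat \<Rightarrow> 'a" where
  "AMR31 q n = (\<Sum>p\<in>Av231 n. of_bool (alternating p) * q ^ v31_2 (Suc (length p) # rev p))"

lemma coderangement_Nil: "coderangement []"
  by (simp add: coderangement_def foremax_def)

lemma alternating_short: "length p \<le> 1 \<Longrightarrow> alternating p"
  by (simp add: alternating_def)

lemma wsum_0:
  "S13 x q 0 = 1" "Z13 x q 0 = 1" "S31 x q 0 = 1" "M31 x q 0 = 1" "MR31 x q 0 = 1"
  "D13 x q 0 = 1" "DR31 x q 0 = 1" "A13 q 0 = 1" "AR31 q 0 = 1" "AMR31 q 0 = 1"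
  by (simp_all add: S13_def Z13_def S31_def M31_def MR31_def D13_def DR31_def A13_def AR31_def
      AMR31_def Av231_0 coderangement_Nil alternating_short)

lemma S13_Suc:
  "S13 x q (Suc n) = (\<Sum>k\<le>n. (if k = 0 then 1 else x * q ^ (n - k)) * S13 x q k * S13 x q (n - k))"
  unfolding S13_def
proof (rule sum_Av231_Suc_prod)
  fix k L R assume "k \<le> n" and L: "L \<in> Av231 k" and R: "R \<in> Av231 (n - k)"
  then show "x ^ asc (glue L R) * q ^ v13_2 (glue L R) = (if k = 0 then 1 else x * q ^ (n - k)) *
      (x ^ asc L * q ^ v13_2 L) * (x ^ asc R * q ^ v13_2 R)"
    unfolding asc_glue[OF L R] v13_2_glue[OF L R] Av231_Nil_iff[OF L] power_add by simp
qed

lemma Z13_Suc: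
  "Z13 x q (Suc n) = (\<Sum>k\<le>n. (if k = 0 then q ^ (n - k) else x * q ^ (n - k)) *
    Z13 x q k * S13 x q (n - k))"
  unfolding S13_def Z13_def
proof (rule sum_Av231_Suc_prod)
  fix k L R assume "k \<le> n" and L: "L \<in> Av231 k" and R: "R \<in> Av231 (n - k)"
  then show "x ^ asc (glue L R) * q ^ v13_2 (0 # glue L R) =
      (if k = 0 then q ^ (n - k) else x * q ^ (n - k)) *
      (x ^ asc L * q ^ v13_2 (0 # L)) * (x ^ asc R * q ^ v13_2 R)"
    unfolding asc_glue[OF L R] v13_2_zero_glue[OF L R] Av231_Nil_iff[OF L] power_add by simp
qed

lemma S31_Suc:
  "S31 x q (Suc n) = (\<Sum>k\<le>n. (if k = 0 then 1 else x) * S31 x q k * M31 x q (n - k))"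
  unfolding S31_def M31_def
proof (rule sum_Av231_Suc_prod)
  fix k L R assume "k \<le> n" and L: "L \<in> Av231 k" and R: "R \<in> Av231 (n - k)"
  then show "x ^ asc (glue L R) * q ^ v31_2 (glue L R) = (if k = 0 then 1 else x) *
      (x ^ asc L * q ^ v31_2 L) * (x ^ asc R * q ^ v31_2 (Suc (length R) # R))"
    unfolding asc_glue[OF L R] v31_2_glue[OF L R] glue_lengths[OF L R] Av231_Nil_iff[OF L] power_add
    by simp
qed

lemma length_glue: "length (glue L R) = Suc (length L + length R)"
  by (simp add: glue_def)

lemma M31_Suc:
  "M31 x q (Suc n) = (\<Sum>k\<le>n. (if k = 0 then 1 else x * q * q ^ (n - k)) *
    M31 x q k * M31 x q (n - k))"
  unfolding M31_def
proof (rule sum_Av231_Suc_prod)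
  fix k L R assume "k \<le> n" and L: "L \<in> Av231 k" and R: "R \<in> Av231 (n - k)"
  then show "x ^ asc (glue L R) * q ^ v31_2 (Suc (length (glue L R)) # glue L R) =
      (if k = 0 then 1 else x * q * q ^ (n - k)) *
      (x ^ asc L * q ^ v31_2 (Suc (length L) # L)) * (x ^ asc R * q ^ v31_2 (Suc (length R) # R))"
    unfolding length_glue glue_lengths[OF L R] v31_2_max_glue[OF L R]
      asc_glue[OF L R] Av231_Nil_iff[OF L] power_add
    by simp
qed

lemma MR31_Suc:
  "MR31 x q (Suc n) = (\<Sum>k\<le>n. ((if k = 0 then 1 else x) * (if n - k = 0 then 1 else q)) *
    MR31 x q k * MR31 x q (n - k))"
  unfolding MR31_def
proof (rule sum_Av231_Suc_prod)
  fix k L R assume "k \<le> n" and L: "L \<in> Av231 k" and R: "R \<in> Av231 (n - k)"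
  then show "x ^ asc (glue L R) * q ^ v31_2 (Suc (length (glue L R)) # rev (glue L R)) =
      ((if k = 0 then 1 else x) * (if n - k = 0 then 1 else q)) *
      (x ^ asc L * q ^ v31_2 (Suc (length L) # rev L)) *
      (x ^ asc R * q ^ v31_2 (Suc (length R) # rev R))"
    unfolding length_glue glue_lengths[OF L R] v31_2_max_rev_glue[OF L R]
      asc_glue[OF L R] Av231_Nil_iff[OF L] Av231_Nil_iff[OF R] power_add
    by simp
qed

lemma D13_Suc:
  "D13 x q (Suc n) = (\<Sum>k\<le>n. (if k = 0 then 0 else x * q ^ (n - k)) * S13 x q k * D13 x q (n - k))"
  unfolding D13_def S13_def
proof (rule sum_Av231_Suc_prod)
  fix k L R assume "k \<le> n" and L: "L \<in> Av231 k" and R: "R \<in> Av231 (n - k)"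
  then show "of_bool (coderangement (rev (glue L R))) * x ^ asc (glue L R) * q ^ v13_2 (glue L R) =
      (if k = 0 then 0 else x * q ^ (n - k)) * (x ^ asc L * q ^ v13_2 L) *
      (of_bool (coderangement (rev R)) * x ^ asc R * q ^ v13_2 R)"
    unfolding asc_glue[OF L R] v13_2_glue[OF L R] coderangement_rev_glue[OF L R]
      Av231_Nil_iff[OF L] power_add by simp
qed

lemma DR31_Suc:
  "DR31 x q (Suc n) = (\<Sum>k\<le>n. (if k = 0 then 0 else x) * MR31 x q k * DR31 x q (n - k))"
  unfolding DR31_def MR31_def
proof (rule sum_Av231_Suc_prod)
  fix k L R assume "k \<le> n" and L: "L \<in> Av231 k" and R: "R \<in> Av231 (n - k)"
  then show "of_bool (coderangement (rev (glue L R))) * x ^ asc (glue L R) *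
      q ^ v31_2 (rev (glue L R)) =
      (if k = 0 then 0 else x) * (x ^ asc L * q ^ v31_2 (Suc (length L) # rev L)) *
      (of_bool (coderangement (rev R)) * x ^ asc R * q ^ v31_2 (rev R))"
    unfolding v31_2_rev_glue[OF L R] glue_lengths[OF L R]
      asc_glue[OF L R] coderangement_rev_glue[OF L R] Av231_Nil_iff[OF L] power_add
    by simp
qed

lemma A13_Suc:
  assumes "0 < n"
  shows "A13 q (Suc n) = (\<Sum>k\<le>n. if odd k then q ^ (n - k) * A13 q k * A13 q (n - k) else 0)"
proof -
  have "A13 q (Suc n) = (\<Sum>k\<le>n. (if odd k then q ^ (n - k) else 0) * A13 q k * A13 q (n - k))"
    unfolding A13_def
  proof (rule sum_Av231_Suc_prod)
    fix k L R assume "k \<le> n" and L: "L \<in> Av231 k" and R: "R \<in> Av231 (n - k)"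
    then show "of_bool (alternating (glue L R)) * q ^ v13_2 (glue L R) =
        (if odd k then q ^ (n - k) else 0) * (of_bool (alternating L) * q ^ v13_2 L) *
        (of_bool (alternating R) * q ^ v13_2 R)"
      unfolding v13_2_glue[OF L R] Av231_Nil_iff[OF L] power_add
      using alternating_glue[OF L R] assms by auto
  qed
  also have "\<dots> = (\<Sum>k\<le>n. if odd k then q ^ (n - k) * A13 q k * A13 q (n - k) else 0)"
    by (intro sum.cong) auto
  finally show ?thesis .
qed

lemma AR31_Suc:
  assumes "0 < n"
  shows "AR31 q (Suc n) = (\<Sum>k\<le>n. if odd k then AMR31 q k * AR31 q (n - k) else 0)"
proof -
  have "AR31 q (Suc n) = (\<Sum>k\<le>n. (if odd k then 1 else 0) * AMR31 q k * AR31 q (n - k))"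
    unfolding AR31_def AMR31_def
  proof (rule sum_Av231_Suc_prod)
    fix k L R assume "k \<le> n" and L: "L \<in> Av231 k" and R: "R \<in> Av231 (n - k)"
    then show "of_bool (alternating (glue L R)) * q ^ v31_2 (rev (glue L R)) =
        (if odd k then 1 else 0) * (of_bool (alternating L) * q ^ v31_2 (Suc (length L) # rev L)) *
        (of_bool (alternating R) * q ^ v31_2 (rev R))"
      unfolding v31_2_rev_glue[OF L R] glue_lengths[OF L R] power_add
      using alternating_glue[OF L R] assms by auto
  qed
  also have "\<dots> = (\<Sum>k\<le>n. if odd k then AMR31 q k * AR31 q (n - k) else 0)"
    by (intro sum.cong) auto
  finally show ?thesis .
qed

lemma AMR31_Suc:
  assumes "0 < n" "even n"
  shows "AMR31 q (Suc n) = q * (\<Sum>k\<le>n. if odd k then AMR31 q k * AMR31 q (n - k) else 0)"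
proof -
  have "AMR31 q (Suc n) = (\<Sum>k\<le>n. (if odd k then q else 0) * AMR31 q k * AMR31 q (n - k))"
    unfolding AMR31_def
  proof (rule sum_Av231_Suc_prod)
    fix k L R assume k: "k \<le> n" and L: "L \<in> Av231 k" and R: "R \<in> Av231 (n - k)"
    \<comment> \<open>An odd left block in a word of odd length leaves a nonempty right block, so
      the extra unit in \<open>v31_2_max_rev_glue\<close> always occurs and \<open>q\<close> can be
      pulled out.\<close>
    have "n - k \<noteq> 0" if "odd k" using that k assms by (cases "n = k") auto
    then show "of_bool (alternating (glue L R)) *
        q ^ v31_2 (Suc (length (glue L R)) # rev (glue L R)) =
        (if odd k then q else 0) * (of_bool (alternating L) * q ^ v31_2 (Suc (length L) # rev L)) *
        (of_bool (alternating R) * q ^ v31_2 (Suc (length R) # rev R))"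
      unfolding v31_2_max_rev_glue[OF L R] length_glue glue_lengths[OF L R]
        Av231_Nil_iff[OF R] power_add
      using alternating_glue[OF L R] assms k by auto
  qed
  also have "\<dots> = q * (\<Sum>k\<le>n. if odd k then AMR31 q k * AMR31 q (n - k) else 0)"
    unfolding sum_distrib_left by (intro sum.cong) auto
  finally show ?thesis .
qed

lemma alternating_sum_1: "A13 q 1 = 1" "AMR31 q 1 = 1"
proof -
  have "Av231 1 = {[1]}"
  proof (intro equalityI subsetI)
    fix p assume p: "p \<in> Av231 1"
    then have "length p = 1" "set p = {1}" using length_perms[of p 1]
      by (auto simp: Av231_iff in_perms_iff)
    then show "p \<in> {[1]}" by (cases p) auto
  qed (auto simp: Av231_iff in_perms_iff has3_def)
  then show "A13 q 1 = 1" "AMR31 q 1 = 1"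
    by (simp_all add: A13_def AMR31_def alternating_short)
qed

section \<open>Evaluation of the weighted sums\<close>

text \<open>For positive \<open>n\<close> the extreme terms \<open>k = 0\<close> and
  \<open>k = n\<close> are \<open>A * s n\<close> and \<open>- A * s n\<close>. Dropping them is the
  same as setting \<open>s 0\<close> to 0, which is what \<open>g\<close> does.\<close>

lemma boundary_terms_cancel:
  fixes s :: "nat \<Rightarrow> 'a::comm_ring_1"
  assumes s0: "s 0 = 1"
    and s: "\<And>n. s (Suc n) = (\<Sum>k\<le>n. W n k * s k * s (n - k))"
    and W0: "W 0 0 = 1"
    and W: "\<And>n. 0 < n \<Longrightarrow> W n 0 = A" "\<And>n. 0 < n \<Longrightarrow> W n n = - A"
      "\<And>n k. 0 < k \<Longrightarrow> k < n \<Longrightarrow> W n k = - c * Q ^ (n - k)"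
  defines "g \<equiv> \<lambda>n. if n = 0 then 0 else s n"
  shows "g (Suc n) = of_bool (n = 0) - c * (\<Sum>k\<le>n. Q ^ (n - k) * g k * g (n - k))"
proof (cases "n = 0")
  case True
  then show ?thesis using s[of 0] by (simp add: g_def s0 W0)
next
  case False
  have "s (Suc n) = (\<Sum>k\<le>n. - c * (Q ^ (n - k) * g k * g (n - k)) +
      ((if k = 0 then A * s n else 0) + (if k = n then - A * s n else 0)))"
    unfolding s
  proof (intro sum.cong refl)
    fix k assume "k \<in> {..n}"
    then consider "k = 0" | "k = n" | "0 < k" "k < n" by fastforce
    then show "W n k * s k * s (n - k) = - c * (Q ^ (n - k) * g k * g (n - k)) +
      ((if k = 0 then A * s n else 0) + (if k = n then - A * s n else 0))"
      by cases (use False W in \<open>simp_all add: g_def s0\<close>)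
  qed
  also have "\<dots> = - c * (\<Sum>k\<le>n. Q ^ (n - k) * g k * g (n - k))"
    unfolding sum.distrib sum_distrib_left by simp
  finally show ?thesis using False by (simp add: g_def)
qed

lemma S13_odd_recurrence:
  defines "g \<equiv> \<lambda>q n. if n = 0 then 0 else S13 (- 1) q n"
  shows "g q (Suc n) = of_bool (n = 0) - 1 * (\<Sum>k\<le>n. q ^ (n - k) * g q k * g q (n - k))"
  unfolding g_def
  by (rule boundary_terms_cancel[where A = 1 and
        W = "\<lambda>n k. if k = 0 then 1 else - 1 * q ^ (n - k)"])
    (simp_all add: wsum_0 S13_Suc)

text \<open>For positive \<open>n\<close> an empty left block has weight \<open>q\<close> and an
  empty right block has weight x, so x = -q balances them. Interior terms have the constant weight x
  q = -q^2, hence dilation factor 1.\<close>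

lemma MR31_odd_recurrence:
  defines "g \<equiv> \<lambda>q n. if n = 0 then 0 else MR31 (- q) q n"
  shows "g q (Suc n) = of_bool (n = 0) - q\<^sup>2 * (\<Sum>k\<le>n. 1 ^ (n - k) * g q k * g q (n - k))"
  unfolding g_def
  by (rule boundary_terms_cancel[where A = q and
        W = "\<lambda>n k. (if k = 0 then 1 else - q) * (if n - k = 0 then 1 else q)"])
    (simp_all add: wsum_0 MR31_Suc power2_eq_square)

lemma S13_eq_Cq:
  assumes "0 < n"
  shows "S13 (- 1) q n = eps_odd n ((- q) ^ ((n - 1) div 2) * Cq ((n - 1) div 2) (q\<^sup>2))"
proof -
  have "(if n = 0 then 0 else S13 (- 1) q n) =
      (if odd n then (- (1 * q)) ^ (n div 2) * Cq (n div 2) (q\<^sup>2) else 0)"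
    by (rule odd_sequence_eq_Cq[where g = "\<lambda>n. if n = 0 then 0 else S13 (- 1) q n"])
      (simp_all only: S13_odd_recurrence if_True simp_thms)
  moreover have "odd n \<Longrightarrow> (n - 1) div 2 = n div 2" by (auto elim: oddE)
  ultimately show ?thesis using assms by (simp add: eps_odd_def)
qed

lemma S31_eq_Cq:
  assumes "0 < n"
  shows "S31 (- 1) q n = eps_odd n ((- q) ^ ((n - 1) div 2) * Cq ((n - 1) div 2) (q\<^sup>2))"
proof -
  let ?G = "Abs_fps (S31 (- 1) q) - 1"
  have "?G = fps_X - fps_const 1 * (fps_X * (?G * dil q ?G))"
    by (rule eliminate_max_series[where h = "M31 (- 1) q"])
      (rule wsum_0 S31_Suc M31_Suc[of "- 1", unfolded mult_minus1])+
  note rec = fps_nth_recurrence[OF this]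
  have "fps_nth ?G n = (if odd n then (- (1 * q)) ^ (n div 2) * Cq (n div 2) (q\<^sup>2) else 0)"
    by (rule odd_sequence_eq_Cq) (rule rec)+
  moreover have "odd n \<Longrightarrow> (n - 1) div 2 = n div 2" by (auto elim: oddE)
  ultimately show ?thesis using assms by (simp add: eps_odd_def)
qed

text \<open>At -q the series \<open>S13\<close> obeys the recurrence that \<open>M31\<close> obeys
  at -1.\<close>

lemma Z13_eq_Cq:
  assumes "0 < n"
  shows "Z13 (- q) q n = eps_odd n ((- (q\<^sup>2 * q)) ^ (n div 2) * Cq (n div 2) (q\<^sup>2))"
proof -
  let ?G = "Abs_fps (Z13 (- q) q) - 1"
  have "?G = fps_X - fps_const (q\<^sup>2) * (fps_X * (?G * dil q ?G))"
    by (rule eliminate_zero_series[where s = "S13 (- q) q"])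
      (rule wsum_0 S13_Suc Z13_Suc)+
  note rec = fps_nth_recurrence[OF this]
  have "fps_nth ?G n = (if odd n then (- (q\<^sup>2 * q)) ^ (n div 2) * Cq (n div 2) (q\<^sup>2) else 0)"
    by (rule odd_sequence_eq_Cq) (rule rec)+
  then show ?thesis using assms by (simp add: eps_odd_def)
qed

text \<open>The signed \<open>S13\<close> is matched with \<open>A13\<close> at odd lengths; since
  it vanishes at even positive ones, the recurrence of \<open>D13\<close> reduces to that of
  \<open>A13\<close> with one sign per step.\<close>

lemma D13_eq_A13: "D13 (- 1) q n = (if even n then (- 1) ^ (n div 2) * A13 q n else 0)"
proof (rule signed_even_sequence[where g = "S13 (- 1) q" and a = "A13 q" and Q = q])
  fix n :: nat assume "0 < n"
  have "(if n = 0 then 0 else S13 (- 1) q n) = (if odd n then (- 1) ^ (n div 2) * A13 q n else 0)"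
    by (rule signed_odd_sequence[where b = 1 and Q = q and
          g = "\<lambda>n. if n = 0 then 0 else S13 (- 1) q n"])
      (use S13_odd_recurrence[where q = q] in
        \<open>simp_all add: A13_Suc alternating_sum_1 del: One_nat_def\<close>)
  with \<open>0 < n\<close> show "S13 (- 1) q n = (if odd n then (- 1) ^ (n div 2) * A13 q n else 0)" by simp
next
  fix n :: nat assume "odd n"
  then show "A13 q (Suc n) = (\<Sum>k\<le>n. if odd k then q ^ (n - k) * A13 q k * A13 q (n - k) else 0)"
    by (intro A13_Suc) (auto intro: Nat.gr0I)
qed (rule wsum_0 D13_Suc)+

text \<open>The prefactor \<open>- q\<^sup>2\<close> of the signed recurrence splits as
  \<open>y = - q\<close> times \<open>b = q\<close>, where \<open>q\<close> already belongs to the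
  recurrence of \<open>AMR31\<close>.\<close>

lemma DR31_eq_AR31: "DR31 (- q) q n = (if even n then (- q) ^ (n div 2) * AR31 q n else 0)"
proof (rule signed_even_sequence[where g = "MR31 (- q) q" and a = "AMR31 q" and Q = 1])
  fix n :: nat assume "0 < n"
  have "(if n = 0 then 0 else MR31 (- q) q n) = (if odd n then (- q) ^ (n div 2) * AMR31 q n else 0)"
    by (rule signed_odd_sequence[where b = q and Q = 1 and
          g = "\<lambda>n. if n = 0 then 0 else MR31 (- q) q n"])
      (use MR31_odd_recurrence[where q = q] in
        \<open>simp_all add: AMR31_Suc alternating_sum_1 power2_eq_square cong: if_cong del: One_nat_def\<close>)
  with \<open>0 < n\<close> show "MR31 (- q) q n = (if odd n then (- q) ^ (n div 2) * AMR31 q n else 0)" by simp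
next
  fix n :: nat assume "odd n"
  then show "AR31 q (Suc n) = (\<Sum>k\<le>n. if odd k then 1 ^ (n - k) * AMR31 q k * AR31 q (n - k) else 0)"
    by (subst AR31_Suc) (auto intro: Nat.gr0I cong: if_cong)
qed (simp_all add: wsum_0 DR31_Suc cong: if_cong)

lemma Chat_eq_A13: "Chat m q = A13 q (2 * m)"
  unfolding Chat_def A13_def alt_avoiders_def Av231_def st13_2_eq_vinc
  unfolding sum.inter_filter[OF finite_avoiders] by (intro sum.cong) auto

lemma Cbar_eq_AR31: "Cbar m q = AR31 q (2 * m)"
  unfolding Cbar_def AR31_def alt_avoiders_def Av231_def st2_13_eq_vinc
  unfolding sum.inter_filter[OF finite_avoiders] by (intro sum.cong) auto

section \<open>Coderangements avoiding 213\<close>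

lemma coder_avoiders_213_Suc:
  "coder_avoiders (Suc m) [2, 1, 3] = (if m = 0 then {} else (#) (Suc m) ` avoiders m [2, 1, 3])"
proof (intro equalityI subsetI)
  fix p assume "p \<in> coder_avoiders (Suc m) [2, 1, 3]"
  then have p: "p \<in> perms (Suc m)" and h: "\<not> has3 (\<lambda>a b c. b < a \<and> a < c) p" and c: "no_foremax p"
    using coderangement_iff_no_foremax unfolding coder_avoiders_def mem_Collect_eq avoiders_213_iff
    by blast+
  have d: "distinct p" and sp: "set p = {1..Suc m}" using p by (auto simp: in_perms_iff)
  have "Suc m \<in> set p" unfolding sp by simp
  then obtain L R where LR: "p = L @ Suc m # R" by (meson split_list)
  have b: "x \<noteq> Suc m" "x \<in> {1..Suc m}" if "x \<in> set L \<union> set R" for x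
    using that d unfolding sp[symmetric] LR by auto
  have lt: "x < Suc m" if "x \<in> set L \<union> set R" for x
    using b[OF that] by simp
  have "no_foremax L" "R \<noteq> []"
    using c no_foremax_append_max[of L "Suc m" R] lt unfolding LR by blast+
  \<comment> \<open>The first letter of a nonempty \<open>L\<close> is a left-to-right maximum, so a
    smaller letter follows it; with \<open>Suc m\<close> behind them these two form a 213.\<close>
  have "L = []"
  proof (rule ccontr)
    assume "L \<noteq> []"
    then have *: "Suc 0 < length L \<and> L ! Suc 0 \<le> L ! 0"
      using \<open>no_foremax L\<close> unfolding no_foremax_def by auto
    have "distinct L" using d LR by simp
    then have "L ! Suc 0 \<noteq> L ! 0"
      using * nth_eq_iff_index_eq[of L "Suc 0" 0] by force
    moreover have "L ! 0 < Suc m" using \<open>L \<noteq> []\<close> by (intro lt) simp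
    ultimately have "has3 (\<lambda>a b c. b < a \<and> a < c) p"
      unfolding has3_append LR using *
      by (intro disjI2 disjI1 exI[of _ 0] exI[of _ "Suc 0"] exI[of _ "Suc m"]) auto
    with h show False ..
  qed
  then have pR: "p = Suc m # R" using LR by simp
  then have "\<not> has3 (\<lambda>a b c. b < a \<and> a < c) R" using h has3_Cons by blast
  moreover have "set R = {1..m}"
  proof -
    have "set R = set p - {Suc m}" using d pR by auto
    also have "\<dots> = {1..m}" unfolding sp by (simp add: atLeastAtMostSuc_conv)
    finally show ?thesis .
  qed
  then have "R \<in> perms m" "m \<noteq> 0" using d pR \<open>R \<noteq> []\<close> by (auto simp: in_perms_iff intro: Nat.gr0I)
  ultimately show "p \<in> (if m = 0 then {} else (#) (Suc m) ` avoiders m [2, 1, 3])"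
    unfolding pR using avoiders_213_iff by (simp del: One_nat_def)
next
  fix p assume "p \<in> (if m = 0 then {} else (#) (Suc m) ` avoiders m [2, 1, 3])"
  then obtain R where m: "m \<noteq> 0" and p: "p = Suc m # R" and R: "R \<in> perms m"
    and h: "\<not> has3 (\<lambda>a b c. b < a \<and> a < c) R"
    using avoiders_213_iff by (auto split: if_splits simp del: One_nat_def)
  have sR: "set R = {1..m}" "distinct R" "length R = m"
    using R length_perms by (auto simp: in_perms_iff)
  have pp: "p \<in> perms (Suc m)" using sR unfolding in_perms_iff p
    by (simp add: atLeastAtMostSuc_conv)
  have le: "x \<le> m" if "x \<in> set R" for x using that unfolding sR by simp
  have "\<not> has3 (\<lambda>a b c. b < a \<and> a < c) p"
  proof
    assume "has3 (\<lambda>a b c. b < a \<and> a < c) p"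
    then obtain k where "k < length R" "Suc m < R ! k" using h unfolding p has3_Cons by blast
    then show False using le[of "R ! k"] by simp
  qed
  moreover have "no_foremax ([] @ Suc m # R)"
    using le m sR(3) by (subst no_foremax_append_max) (auto simp: no_foremax_def less_Suc_eq_le)
  then have "coderangement p" using pp p by (simp add: coderangement_iff_no_foremax)
  ultimately show "p \<in> coder_avoiders (Suc m) [2, 1, 3]"
    using pp unfolding coder_avoiders_def mem_Collect_eq avoiders_213_iff by blast
qed

text \<open>Under \<open>compl m\<close> the leading maximum \<open>Suc m\<close> is the image of a
  leading 0, which is where the 0 in \<open>Z13\<close> comes from.\<close>

lemma sum_coder_avoiders_213_Suc:
  assumes "0 < m"
  shows "(\<Sum>p\<in>coder_avoiders (Suc m) [2, 1, 3]. w p) = (\<Sum>p\<in>Av231 m. w (compl m (0 # p)))"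
proof -
  have "(\<Sum>p\<in>coder_avoiders (Suc m) [2, 1, 3]. w p) = (\<Sum>p\<in>avoiders m [2, 1, 3]. w (Suc m # p))"
    unfolding coder_avoiders_213_Suc using assms by (simp add: sum.reindex)
  also have "\<dots> = (\<Sum>p\<in>Av231 m. w (compl m (0 # p)))"
    unfolding sum_avoiders_213 by (simp add: compl_def)
  finally show ?thesis .
qed

lemma compl_zero_stats:
  assumes "p \<in> perms m" "0 < m"
  shows "des (compl m (0 # p)) = Suc (asc p)"
    and "v31_2 (compl m (0 # p)) = v13_2 (0 # p)"
    and "v13_2 (compl m (0 # p)) = v31_2 p"
proof -
  have b: "0 < x \<and> x \<le> m" if "x \<in> set p" for x using that assms by (auto simp: in_perms_iff)
  have "des (compl m (0 # p)) = asc (0 # p)"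
    unfolding des_eq_adj compl_def adj_map by (intro adj_cong) (auto dest!: b)
  moreover have "asc (0 # p) = Suc (asc p)"
    using assms length_perms[of p m] b[of "hd p"] by (cases p) auto
  ultimately show "des (compl m (0 # p)) = Suc (asc p)" by simp
  show "v31_2 (compl m (0 # p)) = v13_2 (0 # p)"
    unfolding compl_def vinc_map by (intro vinc_cong) (auto dest!: b)
  have "v13_2 (compl m (0 # p)) = v31_2 (0 # p)"
    unfolding compl_def vinc_map by (intro vinc_cong) (auto dest!: b)
  then show "v13_2 (compl m (0 # p)) = v31_2 p" by (simp add: vinc_Cons)
qed

section \<open>Signs by ascents and by descents, and the final identities\<close>

lemma minus_one_power_des:
  assumes "p \<in> Av231 n" "odd n"
  shows "(- 1 :: 'a::ring_1) ^ des p = (- 1) ^ asc p"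
proof -
  have "asc p + des p = n - 1"
    using assms asc_plus_des length_perms[of p n] by (auto simp: Av231_iff in_perms_iff)
  then have "even (asc p + des p)" using assms(2) by simp
  then show ?thesis by (auto simp: minus_one_power_iff)
qed

lemma minus_one_power_des_even:
  assumes "p \<in> Av231 n" "even n" "0 < n"
  shows "(- 1 :: 'a::ring_1) ^ des p = - ((- 1) ^ asc p)"
proof -
  have "asc p + des p = n - 1"
    using assms asc_plus_des length_perms[of p n] by (auto simp: Av231_iff in_perms_iff)
  then have "odd (asc p + des p)" using assms by simp
  then show ?thesis by (auto simp: minus_one_power_iff)
qed

text \<open>Ascents and descents add up to n - 1, so the two signs agree for odd \<open>n\<close>
  and are opposite for even \<open>n\<close>, where the sum is 0 anyway.\<close>

lemma sum_des_eq_sum_asc: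
  fixes u :: "nat list \<Rightarrow> 'a::field"
  assumes "0 < n" and "(\<Sum>p\<in>Av231 n. (- 1) ^ asc p * u p) = eps_odd n c"
  shows "(\<Sum>p\<in>Av231 n. (- 1) ^ des p * u p) = eps_odd n c"
proof (cases "odd n")
  case True
  then have "(\<Sum>p\<in>Av231 n. (- 1) ^ des p * u p) = (\<Sum>p\<in>Av231 n. (- 1) ^ asc p * u p)"
    by (intro sum.cong) (simp_all add: minus_one_power_des)
  then show ?thesis using assms by simp
next
  case False
  then have "(\<Sum>p\<in>Av231 n. (- 1) ^ des p * u p) = - (\<Sum>p\<in>Av231 n. (- 1) ^ asc p * u p)"
    unfolding sum_negf[symmetric] using assms(1)
    by (intro sum.cong) (simp_all add: minus_one_power_des_even)
  then show ?thesis using assms False by (simp add: eps_odd_def)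
qed

lemma sum_coder_avoiders_132:
  "(\<Sum>p\<in>coder_avoiders n [1, 3, 2]. w p) =
    (\<Sum>p\<in>Av231 n. of_bool (coderangement (rev p)) * w (rev p))"
  for w :: "nat list \<Rightarrow> 'a::field"
  unfolding coder_avoiders_def sum.inter_filter[OF finite_avoiders] sum_avoiders_132
  by (intro sum.cong) auto

lemma coder_213_minus_one:
  fixes q :: "'a::field"
  assumes "0 < n"
  shows "(\<Sum>p\<in>coder_avoiders n [2, 1, 3]. (- 1) ^ des p * q ^ st13_2 p) =
    eps_even n ((- 1) ^ (n div 2) * q ^ ((n - 2) div 2) * Cq ((n - 2) div 2) (q\<^sup>2))"
proof (cases "n = 1")
  case True
  then show ?thesis using coder_avoiders_213_Suc[of 0] by (simp add: eps_even_def)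
next
  case False
  with assms obtain m where n: "n = Suc m" "0 < m" by (cases n) auto
  have "(\<Sum>p\<in>coder_avoiders n [2, 1, 3]. (- 1) ^ des p * q ^ st13_2 p) =
      (\<Sum>p\<in>Av231 m. - ((- 1) ^ asc p * q ^ v31_2 p))"
    unfolding n(1) sum_coder_avoiders_213_Suc[OF n(2)] st13_2_eq_vinc
    using n(2) by (intro sum.cong refl) (simp add: Av231_iff compl_zero_stats)
  also have "\<dots> = - S31 (- 1) q m" by (simp add: S31_def sum_negf)
  also have "\<dots> = eps_even n ((- 1) ^ (n div 2) * q ^ ((n - 2) div 2) * Cq ((n - 2) div 2) (q\<^sup>2))"
    unfolding S31_eq_Cq[OF n(2)]
    by (auto simp: eps_odd_def eps_even_def n elim!: oddE)
      (simp_all add: power_minus[of q])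
  finally show ?thesis .
qed

text \<open>The descent after the leading maximum contributes the factor -q. With n = 2j + 2 the
  rest supplies (-q^3)^j, and 3j + 1 = (3n - 4)/2.\<close>

lemma coder_213_minus_q:
  fixes q :: "'a::field"
  assumes "0 < n"
  shows "(\<Sum>p\<in>coder_avoiders n [2, 1, 3]. (- q) ^ des p * q ^ st31_2 p) =
    eps_even n ((- 1) ^ (n div 2) * q ^ ((3 * n - 4) div 2) * Cq ((n - 2) div 2) (q\<^sup>2))"
proof (cases "n = 1")
  case True
  then show ?thesis using coder_avoiders_213_Suc[of 0] by (simp add: eps_even_def)
next
  case False
  with assms obtain m where n: "n = Suc m" "0 < m" by (cases n) auto
  have "(\<Sum>p\<in>coder_avoiders n [2, 1, 3]. (- q) ^ des p * q ^ st31_2 p) =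
      (\<Sum>p\<in>Av231 m. - q * ((- q) ^ asc p * q ^ v13_2 (0 # p)))"
    unfolding n(1) sum_coder_avoiders_213_Suc[OF n(2)] st31_2_eq_vinc
    using n(2) by (intro sum.cong refl) (simp add: Av231_iff compl_zero_stats)
  also have "\<dots> = - q * Z13 (- q) q m" by (simp only: Z13_def sum_distrib_left)
  also have "\<dots> = eps_even n ((- 1) ^ (n div 2) * q ^ ((3 * n - 4) div 2) * Cq ((n - 2) div 2) (q\<^sup>2))"
  proof (cases "odd m")
    case True
    then obtain j where m: "m = 2 * j + 1" by (elim oddE)
    have "(- (q\<^sup>2 * q)) ^ j = (- 1) ^ j * q ^ (3 * j)"
      unfolding power_mult power_mult_distrib[symmetric] by (simp add: power2_eq_square power3_eq_cube)
    then have "- q * (- (q\<^sup>2 * q)) ^ j = (- 1) ^ Suc j * q ^ (3 * j + 1)"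
      by (simp add: ac_simps)
    moreover have "(3 * n - 4) div 2 = 3 * j + 1" "n div 2 = Suc j" "(n - 2) div 2 = j" "m div 2 = j"
      unfolding n(1) m by simp_all
    moreover have "even n" using True n(1) by simp
    ultimately show ?thesis
      unfolding Z13_eq_Cq[OF n(2)] eps_odd_def eps_even_def
      using True by (simp only: not_False_eq_True if_True mult.assoc[symmetric])
  next
    case False
    then show ?thesis unfolding Z13_eq_Cq[OF n(2)] n(1) by (simp add: eps_odd_def eps_even_def)
  qed
  finally show ?thesis .
qed

theorem theorem5p6:
  fixes n :: nat and q :: "'a::field"
  assumes "n \<ge> 1"
  shows
   "(\<Sum>p\<in>avoiders n [1,3,2]. (-1) ^ des p * q ^ st2_31 p) =
      eps_odd n ((-q) ^ ((n - 1) div 2) * Cq ((n - 1) div 2) (q^2)) \<and>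
    (\<Sum>p\<in>avoiders n [1,3,2]. (-1) ^ des p * q ^ st2_13 p) =
      eps_odd n ((-q) ^ ((n - 1) div 2) * Cq ((n - 1) div 2) (q^2)) \<and>
    (\<Sum>p\<in>avoiders n [2,1,3]. (-1) ^ des p * q ^ st31_2 p) =
      eps_odd n ((-q) ^ ((n - 1) div 2) * Cq ((n - 1) div 2) (q^2)) \<and>
    (\<Sum>p\<in>avoiders n [2,1,3]. (-1) ^ des p * q ^ st13_2 p) =
      eps_odd n ((-q) ^ ((n - 1) div 2) * Cq ((n - 1) div 2) (q^2)) \<and>
    (\<Sum>p\<in>avoiders n [3,1,2]. (-1) ^ des p * q ^ st2_31 p) =
      eps_odd n ((-q) ^ ((n - 1) div 2) * Cq ((n - 1) div 2) (q^2)) \<and>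
    (\<Sum>p\<in>avoiders n [3,1,2]. (-1) ^ des p * q ^ st2_13 p) =
      eps_odd n ((-q) ^ ((n - 1) div 2) * Cq ((n - 1) div 2) (q^2)) \<and>
    (\<Sum>p\<in>coder_avoiders n [1,3,2]. (-1) ^ des p * q ^ st2_31 p) =
      eps_even n ((-1) ^ (n div 2) * Chat (n div 2) q) \<and>
    (\<Sum>p\<in>coder_avoiders n [1,3,2]. (-q) ^ des p * q ^ st31_2 p) =
      eps_even n ((-q) ^ (n div 2) * Cbar (n div 2) q) \<and>
    (\<Sum>p\<in>coder_avoiders n [2,1,3]. (-1) ^ des p * q ^ st13_2 p) =
      eps_even n ((-1) ^ (n div 2) * q ^ ((n - 2) div 2) * Cq ((n - 2) div 2) (q^2)) \<and>
    (\<Sum>p\<in>coder_avoiders n [2,1,3]. (-q) ^ des p * q ^ st31_2 p) =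
      eps_even n ((-1) ^ (n div 2) * q ^ ((3 * n - 4) div 2) * Cq ((n - 2) div 2) (q^2))"
proof -
  let ?E = "eps_odd n ((-q) ^ ((n - 1) div 2) * Cq ((n - 1) div 2) (q^2))"
  have n: "0 < n" using assms by simp
  note S = S13_eq_Cq[OF n, of q, unfolded S13_def] S31_eq_Cq[OF n, of q, unfolded S31_def]
  note S' = S[THEN sum_des_eq_sum_asc[OF n]]
  have c213: "(\<Sum>p\<in>Av231 n. (- 1) ^ des (compl n p) * q ^ f (compl n p)) =
      (\<Sum>p\<in>Av231 n. (- 1) ^ asc p * q ^ g p)"
    if "\<And>p. p \<in> perms n \<Longrightarrow> f (compl n p) = g p" for f g
    using that by (intro sum.cong refl) (simp add: Av231_iff st_compl)
  \<comment> \<open>Reversal and complementation each exchange ascents and descents, so for 312 the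
    sign stays with the descents and the sums \<open>S'\<close> are the ones required.\<close>
  have c312: "(\<Sum>p\<in>Av231 n. (- 1) ^ asc (compl n p) * q ^ f (compl n p)) =
      (\<Sum>p\<in>Av231 n. (- 1) ^ des p * q ^ g p)"
    if "\<And>p. p \<in> perms n \<Longrightarrow> f (compl n p) = g p" for f g
    using that by (intro sum.cong refl) (simp add: Av231_iff st_compl)
  have 1: "(\<Sum>p\<in>avoiders n [1,3,2]. (-1) ^ des p * q ^ st2_31 p) = ?E"
    unfolding sum_avoiders_132 des_rev st2_31_eq_vinc rev_rev_ident by (rule S)
  have 2: "(\<Sum>p\<in>avoiders n [1,3,2]. (-1) ^ des p * q ^ st2_13 p) = ?E"
    unfolding sum_avoiders_132 des_rev st2_13_eq_vinc rev_rev_ident by (rule S)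
  have 3: "(\<Sum>p\<in>avoiders n [2,1,3]. (-1) ^ des p * q ^ st31_2 p) = ?E"
    unfolding sum_avoiders_213 st31_2_eq_vinc
    by (rule trans[OF c213[of v31_2 v13_2] S(1)]) (rule st_compl)
  have 4: "(\<Sum>p\<in>avoiders n [2,1,3]. (-1) ^ des p * q ^ st13_2 p) = ?E"
    unfolding sum_avoiders_213 st13_2_eq_vinc
    by (rule trans[OF c213[of v13_2 v31_2] S(2)]) (rule st_compl)
  have 5: "(\<Sum>p\<in>avoiders n [3,1,2]. (-1) ^ des p * q ^ st2_31 p) = ?E"
    unfolding sum_avoiders_312 des_rev st2_31_eq_vinc rev_rev_ident
    by (rule trans[OF c312[of v13_2 v31_2] S'(2)]) (rule st_compl)
  have 6: "(\<Sum>p\<in>avoiders n [3,1,2]. (-1) ^ des p * q ^ st2_13 p) = ?E"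
    unfolding sum_avoiders_312 des_rev st2_13_eq_vinc rev_rev_ident
    by (rule trans[OF c312[of v31_2 v13_2] S'(1)]) (rule st_compl)
  have 7: "(\<Sum>p\<in>coder_avoiders n [1,3,2]. (-1) ^ des p * q ^ st2_31 p) =
      eps_even n ((-1) ^ (n div 2) * Chat (n div 2) q)"
    using D13_eq_A13[of q n]
    unfolding sum_coder_avoiders_132 des_rev st2_31_eq_vinc rev_rev_ident D13_def Chat_eq_A13
    by (simp add: eps_even_def mult.assoc)
  have 8: "(\<Sum>p\<in>coder_avoiders n [1,3,2]. (-q) ^ des p * q ^ st31_2 p) =
      eps_even n ((-q) ^ (n div 2) * Cbar (n div 2) q)"
    using DR31_eq_AR31[of q n]
    unfolding sum_coder_avoiders_132 des_rev st31_2_eq_vinc DR31_def Cbar_eq_AR31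
    by (simp add: eps_even_def mult.assoc)
  show ?thesis
    by (intro conjI 1 2 3 4 5 6 7 8 coder_213_minus_one[OF n] coder_213_minus_q[OF n])
qed

end
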